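(* Let $\mathcal{H}$ be a complex separable Hilbert space, let $A\in\mathcal{B}(\mathcal{H})$ be an invertible self-adjoint operator, and let $\mathcal{G}$ be a countable set in $\mathcal{H}$. Then $\{A^tg\}_{g\in\mathcal{G},\,t\in[0,1]}$ is a semi-continuous frame in $\mathcal{H}$ if and only if $\{A^tg\}_{g\in\mathcal{G},\,t\in[0,L]}$ is a semi-continuous frame in $\mathcal{H}$ for all finite positive $L$.
   Context: Invertible means having a bounded inverse. $\{A^tg\}_{g\in\mathcal{G},t\in[0,L]}$ is a semi-continuous frame in $\mathcal{H}$ if there are constants $c,C>0$ with $c\|f\|^2\le\sum_{g\in\mathcal{G}}\int_0^L|\langle f,A^tg\rangle|^2dt\le C\|f\|^2$ for all $f\in\mathcal{H}$. For an invertible self-adjoint (hence normal) operator $A$ with spectral measure $E$, $A^t=\int_{\sigma(A)}z^t\,dE(z)$, where $z^t=\exp(t(\ln|z|+i\arg z))$ with $\arg z\in[-\pi,\pi)$. (The operator $A$ is not assumed positive.) *)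

theory Defs
  imports "HOL-Analysis.Analysis"
begin

(* The norm and the real scalar multiplication are those of real_normed_vector; the axioms
   identify them with the ones induced by cinner and scaleC. cinner is linear in its first
   argument. *)
class complex_inner = real_normed_vector +
  fixes scaleC :: "complex \<Rightarrow> 'a \<Rightarrow> 'a" (infixr "*\<^sub>C" 75)
    and cinner :: "'a \<Rightarrow> 'a \<Rightarrow> complex"
  assumes scaleC_add_right: "a *\<^sub>C (x + y) = a *\<^sub>C x + a *\<^sub>C y"
    and scaleC_add_left: "(a + b) *\<^sub>C x = a *\<^sub>C x + b *\<^sub>C x"
    and scaleC_scaleC: "a *\<^sub>C b *\<^sub>C x = (a * b) *\<^sub>C x"
    and scaleR_scaleC: "r *\<^sub>R x = complex_of_real r *\<^sub>C x"
    and cinner_commute: "cinner x y = cnj (cinner y x)"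
    and cinner_add_left: "cinner (x + y) z = cinner x z + cinner y z"
    and cinner_scaleC_left: "cinner (a *\<^sub>C x) y = a * cinner x y"
    and cinner_self: "cinner x x = complex_of_real ((norm x)\<^sup>2)"

class chilbert_space = complex_inner + complete_space

definition bounded_clinear :: "('a::complex_inner \<Rightarrow> 'b::complex_inner) \<Rightarrow> bool" where
  "bounded_clinear T \<longleftrightarrow> bounded_linear T \<and> (\<forall>c x. T (c *\<^sub>C x) = c *\<^sub>C T x)"

definition op_invertible :: "('a::complex_inner \<Rightarrow> 'a) \<Rightarrow> bool" where
  "op_invertible T \<longleftrightarrow> (\<exists>B. bounded_clinear B \<and> T \<circ> B = id \<and> B \<circ> T = id)"

definition selfadjoint :: "('a::complex_inner \<Rightarrow> 'a) \<Rightarrow> bool" where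
  "selfadjoint T \<longleftrightarrow> (\<forall>x y. cinner (T x) y = cinner x (T y))"

definition op_spectrum :: "('a::complex_inner \<Rightarrow> 'a) \<Rightarrow> complex set" where
  "op_spectrum T = {z. \<not> op_invertible (\<lambda>x. T x - z *\<^sub>C x)}"

definition orthogonal_projection :: "('a::complex_inner \<Rightarrow> 'a) \<Rightarrow> bool" where
  "orthogonal_projection P \<longleftrightarrow> bounded_clinear P \<and> P \<circ> P = P \<and> selfadjoint P"

(* Only the values of E on Borel sets matter. *)
definition projection_valued_measure :: "(complex set \<Rightarrow> 'a::complex_inner \<Rightarrow> 'a) \<Rightarrow> bool" where
  "projection_valued_measure E \<longleftrightarrow>
     (\<forall>S\<in>sets borel. orthogonal_projection (E S)) \<and>
     E {} = (\<lambda>_. 0) \<and> E UNIV = id \<and>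
     (\<forall>S\<in>sets borel. \<forall>S'\<in>sets borel. E (S \<inter> S') = E S \<circ> E S') \<and>
     (\<forall>F::nat \<Rightarrow> complex set. range F \<subseteq> sets borel \<longrightarrow> disjoint_family F \<longrightarrow>
        (\<forall>f. (\<lambda>n. E (F n) f) sums E (\<Union>n. F n) f))"

(* The finite positive measure S \<mapsto> \<langle>E(S)f, f\<rangle>; the inner product is real
   since E(S) is an orthogonal projection. *)
definition scalar_measure ::
    "(complex set \<Rightarrow> 'a::complex_inner \<Rightarrow> 'a) \<Rightarrow> 'a \<Rightarrow> complex measure" where
  "scalar_measure E f = measure_of UNIV (sets borel) (\<lambda>S. ennreal (Re (cinner (E S f) f)))"

(* T is the integral of \<phi> over S with respect to E. In a complex space an operator is
   determined by its quadratic form, so it suffices to integrate against the scalar measures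
   of single vectors. *)
definition has_spectral_integral ::
    "(complex set \<Rightarrow> 'a::complex_inner \<Rightarrow> 'a) \<Rightarrow> complex set \<Rightarrow> (complex \<Rightarrow> complex) \<Rightarrow> ('a \<Rightarrow> 'a) \<Rightarrow> bool"
  where
  "has_spectral_integral E S \<phi> T \<longleftrightarrow>
     bounded_clinear T \<and>
     (\<forall>f. set_integrable (scalar_measure E f) S \<phi> \<and>
          cinner (T f) f = (LINT z:S|scalar_measure E f. \<phi> z))"

definition is_spectral_measure ::
    "('a::complex_inner \<Rightarrow> 'a) \<Rightarrow> (complex set \<Rightarrow> 'a \<Rightarrow> 'a) \<Rightarrow> bool" where
  "is_spectral_measure A E \<longleftrightarrow>
     projection_valued_measure E \<and> E (op_spectrum A) = id \<and>
     has_spectral_integral E (op_spectrum A) (\<lambda>z. z) A"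

(* The library's Arg takes values in the interval (-pi, pi]; here the argument is taken in
   [-pi, pi), which only changes it on the negative half-line. *)
definition arg_neg :: "complex \<Rightarrow> real" where
  "arg_neg z = (if Arg z = pi then - pi else Arg z)"

definition cpow :: "complex \<Rightarrow> real \<Rightarrow> complex" where
  "cpow z t = exp (complex_of_real t * (complex_of_real (ln (cmod z)) + \<i> * complex_of_real (arg_neg z)))"

(* For invertible self-adjoint A on a Hilbert space there is exactly one such T, by existence
   and uniqueness of the spectral measure. *)
definition op_power :: "('a::complex_inner \<Rightarrow> 'a) \<Rightarrow> real \<Rightarrow> 'a \<Rightarrow> 'a" where
  "op_power A t = (THE T. \<exists>E. is_spectral_measure A E \<and>
      has_spectral_integral E (op_spectrum A) (\<lambda>z. cpow z t) T)"

(* Sum and integral are taken in [0, \<infinity>], so no convergence conditions are needed. *)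
definition semicontinuous_frame ::
    "('a::complex_inner \<Rightarrow> 'a) \<Rightarrow> 'a set \<Rightarrow> real \<Rightarrow> bool" where
  "semicontinuous_frame A G L \<longleftrightarrow>
     (\<exists>c>0. \<exists>C>0. \<forall>f.
        ennreal (c * (norm f)\<^sup>2)
          \<le> (\<Sum>\<^sub>\<infinity>g\<in>G. \<integral>\<^sup>+t\<in>{0..L}. ennreal ((cmod (cinner f (op_power A t g)))\<^sup>2) \<partial>lborel) \<and>
        (\<Sum>\<^sub>\<infinity>g\<in>G. \<integral>\<^sup>+t\<in>{0..L}. ennreal ((cmod (cinner f (op_power A t g)))\<^sup>2) \<partial>lborel)
          \<le> ennreal (C * (norm f)\<^sup>2))"

end

theory Submission
  imports Defs "HOL-Computational_Algebra.Polynomial"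
begin

text \<open>
  Write \<open>U t\<close> for the adjoint of \<open>A\<^sup>t\<close>, so that the frame integral over \<open>[0, L]\<close> is the energy
  \<open>Q\<^sub>L(f) = \<Sum>\<^sub>g \<integral>\<^sub>0\<^sup>L |\<langle>U t f, g\<rangle>|\<^sup>2 dt\<close>. The spectrum of \<open>A\<close> is a compact subset of the real line
  avoiding \<open>0\<close>, hence \<open>U\<close> is a one-parameter group with \<open>\<parallel>U h - 1\<parallel> \<le> M h\<close>. Upper bounds pass to longer
  times by splitting \<open>[0, n]\<close> into unit intervals. For lower bounds on a short interval, put
  \<open>D = U h - 1\<close> with \<open>h = s / N\<close> and expand \<open>U s = (1 + D)\<^sup>N\<close> by the binomial theorem: the tail of
  the expansion is dominated by the tail of the exponential series for \<open>M s\<close>, uniformly in \<open>N\<close>, and its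
  first \<open>K\<close> terms only involve times up to \<open>K h\<close>, which tends to \<open>0\<close>. So the energy of \<open>U s f\<close> is
  controlled by the energy of \<open>f\<close> over a short interval, up to an arbitrarily small multiple
  of \<open>\<parallel>f\<parallel>\<^sup>2\<close>.

  For any spectral measure of \<open>A\<close>, \<open>\<langle>p(A) f, f\<rangle>\<close> is the integral of \<open>p\<close> against the scalar measure of \<open>f\<close>,
  for every polynomial \<open>p\<close>. Hence \<open>A\<^sup>t\<close> is a norm limit of polynomials in \<open>A\<close>, which gives its existence,
  its independence of the spectral measure, the group law and the adjoints.

  Existence of a spectral measure is never needed: without one, \<open>op_power A t\<close> is an unspecified
  operator that does not depend on \<open>t\<close>, and the frame integrals are proportional to \<open>L\<close>.
\<close>

section \<open>Complex inner products\<close>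

lemma cinner_add_right: "cinner x (y + z) = cinner x y + cinner x z"
  by (metis cinner_add_left cinner_commute complex_cnj_add)

lemma cinner_scaleC_right: "cinner x (a *\<^sub>C y) = cnj a * cinner x y"
  by (metis cinner_commute cinner_scaleC_left complex_cnj_mult)

lemma scaleC_one [simp]: "1 *\<^sub>C (x::'a::complex_inner) = x"
  using scaleR_scaleC[of 1 x] by simp

lemma scaleC_zero_left [simp]: "0 *\<^sub>C (x::'a::complex_inner) = 0"
  using scaleR_scaleC[of 0 x] by simp

lemma scaleC_zero_right [simp]: "a *\<^sub>C (0::'a::complex_inner) = 0"
  using scaleC_add_right[of a 0 "0::'a"] by simp

lemma uminus_scaleC: "- x = (- 1) *\<^sub>C (x::'a::complex_inner)"
  using scaleR_scaleC[of "-1" x] by simp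

lemma scaleC_minus_right: "a *\<^sub>C (- x) = - (a *\<^sub>C (x::'a::complex_inner))"
  by (simp add: uminus_scaleC scaleC_scaleC mult.commute)

lemma scaleC_diff_right: "a *\<^sub>C (x - y) = a *\<^sub>C x - a *\<^sub>C (y::'a::complex_inner)"
  using scaleC_add_right[of a x "- y"] by (simp add: scaleC_minus_right)

lemma scaleC_sum_right: "a *\<^sub>C (\<Sum>i\<in>I. f i) = (\<Sum>i\<in>I. a *\<^sub>C (f i::'a::complex_inner))"
  by (induction I rule: infinite_finite_induct) (auto simp: scaleC_add_right)

lemma cinner_minus_left: "cinner (- x) y = - cinner x y"
  by (simp add: uminus_scaleC[of x] cinner_scaleC_left)

lemma cinner_minus_right: "cinner x (- y) = - cinner x y"
  by (simp add: uminus_scaleC[of y] cinner_scaleC_right)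

lemma cinner_diff_left: "cinner (x - y) z = cinner x z - cinner y z"
  using cinner_add_left[of x "- y" z] by (simp add: cinner_minus_left)

lemma cinner_diff_right: "cinner x (y - z) = cinner x y - cinner x z"
  using cinner_add_right[of x y "- z"] by (simp add: cinner_minus_right)

lemma cinner_zero_left [simp]: "cinner 0 (y::'a::complex_inner) = 0"
  using cinner_scaleC_left[of 0 0 y] by simp

lemma cinner_zero_right [simp]: "cinner (x::'a::complex_inner) 0 = 0"
  using cinner_scaleC_right[of x 0 0] by simp

lemma cinner_sum_left: "cinner (\<Sum>i\<in>I. f i) y = (\<Sum>i\<in>I. cinner (f i) (y::'a::complex_inner))"
  by (induction I rule: infinite_finite_induct) (auto simp: cinner_add_left)

lemma cinner_scaleR_left: "cinner (r *\<^sub>R x) y = of_real r * cinner x y"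
  by (simp add: scaleR_scaleC cinner_scaleC_left)

lemma cinner_scaleR_right: "cinner x (r *\<^sub>R y) = of_real r * cinner x y"
  by (simp add: scaleR_scaleC cinner_scaleC_right)

lemma mult_cnj_eq_cmod_power2: "z * cnj z = (complex_of_real (cmod z))\<^sup>2"
  by (simp flip: complex_norm_square of_real_power)

lemma cnj_mult_eq_cmod_power2: "cnj z * z = (complex_of_real (cmod z))\<^sup>2"
  by (simp add: mult_cnj_eq_cmod_power2 mult.commute[of "cnj z"])

lemma norm_scaleC: "norm (a *\<^sub>C x) = cmod a * norm (x::'a::complex_inner)"
proof -
  have "complex_of_real ((norm (a *\<^sub>C x))\<^sup>2) = of_real ((cmod a * norm x)\<^sup>2)"
    using cinner_self[of "a *\<^sub>C x"] cinner_self[of x]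
    by (simp add: cinner_scaleC_left cinner_scaleC_right power_mult_distrib
        mult_cnj_eq_cmod_power2 cnj_mult_eq_cmod_power2 flip: mult.assoc)
  then have "(norm (a *\<^sub>C x))\<^sup>2 = (cmod a * norm x)\<^sup>2"
    using of_real_eq_iff by blast
  then show ?thesis
    by (simp add: power2_eq_iff_nonneg)
qed

lemma Re_cinner_commute: "Re (cinner x y) = Re (cinner y (x::'a::complex_inner))"
  by (subst cinner_commute) simp

lemma Re_cinner_self: "Re (cinner x x) = (norm (x::'a::complex_inner))\<^sup>2"
  by (simp add: cinner_self)

lemma power2_norm_add: "(norm (x + y))\<^sup>2 = (norm x)\<^sup>2 + 2 * Re (cinner x y) + (norm (y::'a::complex_inner))\<^sup>2"
  using Re_cinner_self[of "x + y"] Re_cinner_commute[of x y]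
  by (simp add: cinner_add_left cinner_add_right Re_cinner_self)

lemma power2_norm_diff: "(norm (x - y))\<^sup>2 = (norm x)\<^sup>2 - 2 * Re (cinner x y) + (norm (y::'a::complex_inner))\<^sup>2"
  using power2_norm_add[of x "- y"] by (simp add: cinner_minus_right)

text \<open>Cauchy-Schwarz: the squared norm of \<open>x - a *\<^sub>C y\<close> is nonnegative when
  \<open>a *\<^sub>C y\<close> is the orthogonal projection of \<open>x\<close> onto the line
  through \<open>y\<close>.\<close>

lemma cmod_cinner_le: "cmod (cinner x y) \<le> norm x * norm (y::'a::complex_inner)"
proof (cases "y = 0")
  case False
  define a where "a = cinner x y / of_real ((norm y)\<^sup>2)"
  have ny: "norm y > 0" using False by simp
  have "cinner x (a *\<^sub>C y) = of_real ((cmod (cinner x y))\<^sup>2 / (norm y)\<^sup>2)"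
    by (simp add: cinner_scaleC_right a_def mult_cnj_eq_cmod_power2 mult.commute[of "cnj _"])
  then have "Re (cinner x (a *\<^sub>C y)) = (cmod (cinner x y))\<^sup>2 / (norm y)\<^sup>2"
    by (metis Re_complex_of_real)
  moreover have "(norm (a *\<^sub>C y))\<^sup>2 = (cmod (cinner x y))\<^sup>2 / (norm y)\<^sup>2"
    using ny by (simp add: norm_scaleC a_def norm_divide norm_mult power2_eq_square)
  ultimately have "0 \<le> (norm x)\<^sup>2 - (cmod (cinner x y))\<^sup>2 / (norm y)\<^sup>2"
    using power2_norm_diff[of x "a *\<^sub>C y"] zero_le_power2[of "norm (x - a *\<^sub>C y)"] by linarith
  then have "(cmod (cinner x y))\<^sup>2 \<le> (norm x * norm y)\<^sup>2"
    using ny by (simp add: field_simps power_mult_distrib)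
  then show ?thesis
    by (simp add: power2_le_iff_abs_le abs_mult)
qed simp

lemma eq_zero_if_cinner_zero: "(\<And>y. cinner x y = 0) \<Longrightarrow> x = (0::'a::complex_inner)"
  using cinner_self[of x] by auto

lemma bounded_linear_cinner_left: "bounded_linear (\<lambda>x. cinner x (y::'a::complex_inner))"
proof
  show "\<exists>K. \<forall>x. cmod (cinner x y) \<le> norm x * K"
    using cmod_cinner_le by blast
qed (auto simp: cinner_add_left cinner_scaleR_left scaleR_conv_of_real)

section \<open>Bounded complex-linear operators and their quadratic forms\<close>

lemma bounded_clinear_bounded_linear: "bounded_clinear T \<Longrightarrow> bounded_linear T"
  by (simp add: bounded_clinear_def)

lemma bounded_clinear_add: "bounded_clinear T \<Longrightarrow> T (x + y) = T x + T y"
  by (simp add: bounded_clinear_def linear_simps)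

lemma bounded_clinear_diff: "bounded_clinear T \<Longrightarrow> T (x - y) = T x - T y"
  by (simp add: bounded_clinear_def linear_simps)

lemma bounded_clinear_zero: "bounded_clinear T \<Longrightarrow> T 0 = 0"
  by (simp add: bounded_clinear_def linear_simps)

lemma bounded_clinear_scaleC: "bounded_clinear T \<Longrightarrow> T (c *\<^sub>C x) = c *\<^sub>C T x"
  by (simp add: bounded_clinear_def)

lemma bounded_clinear_scaleR: "bounded_clinear T \<Longrightarrow> T (c *\<^sub>R x) = c *\<^sub>R T x"
  by (simp add: bounded_clinear_scaleC scaleR_scaleC)

lemmas bounded_clinear_simps =
  bounded_clinear_add bounded_clinear_diff bounded_clinear_zero bounded_clinear_scaleC
  bounded_clinear_scaleR

lemma bounded_clinear_bound: "bounded_clinear T \<Longrightarrow> \<exists>K>0. \<forall>x. norm (T x) \<le> K * norm x"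
  using bounded_linear.pos_bounded[of T] by (auto simp: bounded_clinear_def mult.commute)

lemma bounded_clinearI:
  assumes "\<And>x y. T (x + y) = T x + T y" "\<And>c x. T (c *\<^sub>C x) = c *\<^sub>C T x"
    and "\<And>x. norm (T x) \<le> K * norm x"
  shows "bounded_clinear T"
  unfolding bounded_clinear_def
  by (intro conjI bounded_linear_intro[where K = K] allI)
     (use assms in \<open>auto simp: scaleR_scaleC mult.commute\<close>)

lemma bounded_clinear_compose:
  "bounded_clinear S \<Longrightarrow> bounded_clinear T \<Longrightarrow> bounded_clinear (\<lambda>x. S (T x))"
  by (auto simp: bounded_clinear_def intro: bounded_linear_compose)

text \<open>Over the complex numbers, the form with \<open>y\<close> replaced by \<open>\<i> y\<close> recovers the imaginary part.\<close>

lemma bounded_clinear_eqI_form: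
  assumes S: "bounded_clinear S" and T: "bounded_clinear T"
    and form: "\<And>f. cinner (S f) f = cinner (T f) (f::'a::complex_inner)"
  shows "S = T"
proof
  fix x
  define D where "D = (\<lambda>x. S x - T x)"
  have D: "D (u + v) = D u + D v" "D (c *\<^sub>C u) = c *\<^sub>C D u" "cinner (D u) u = 0" for u v c
    by (auto simp: D_def bounded_clinear_simps[OF S] bounded_clinear_simps[OF T]
        scaleC_diff_right cinner_diff_left form)
  have sym: "cinner (D u) v + cinner (D v) u = 0" for u v
    using D(3)[of "u + v"] by (simp add: D cinner_add_left cinner_add_right add.commute)
  have "cinner (D u) v = 0" for u v
    using sym[of u v] sym[of u "\<i> *\<^sub>C v"]
    by (simp add: D cinner_scaleC_left cinner_scaleC_right)
  then have "D x = 0" by (rule eq_zero_if_cinner_zero)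
  then show "S x = T x" by (simp add: D_def)
qed

text \<open>The norm of a self-adjoint operator is controlled by its numerical radius, by
  polarization and the parallelogram law. Only vectors of \<open>W\<close> enter the polarization,
  so a form bound on the range of a spectral projection gives a norm bound on that range.\<close>

lemma selfadjoint_norm_le_form:
  fixes T :: "'a::complex_inner \<Rightarrow> 'a"
  assumes T: "bounded_clinear T" and sa: "selfadjoint T"
    and W: "u \<in> W" "T u \<in> W" "\<And>x y. x \<in> W \<Longrightarrow> y \<in> W \<Longrightarrow> x + y \<in> W"
           "\<And>r x. x \<in> W \<Longrightarrow> r *\<^sub>R x \<in> W"
    and form: "\<And>w. w \<in> W \<Longrightarrow> \<bar>Re (cinner (T w) w)\<bar> \<le> r * (norm w)\<^sup>2"
  shows "norm (T u) \<le> r * norm u"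
proof (cases "T u = 0 \<or> u = 0")
  case True
  have "r * (norm u)\<^sup>2 \<ge> 0" using form[OF W(1)] by linarith
  then have "r * norm u \<ge> 0"
    by (simp add: zero_le_mult_iff)
  then show ?thesis using True bounded_clinear_zero[OF T] by auto
next
  case False
  then have pos: "norm (T u) > 0" "norm u > 0" by auto
  \<comment> \<open>Rescaling \<open>T u\<close> to the length of \<open>u\<close> makes the
    parallelogram law return exactly \<open>4 * (norm u)\<^sup>2\<close>.\<close>
  define v where "v = (norm u / norm (T u)) *\<^sub>R T u"
  have v: "v \<in> W" "norm v = norm u" using W pos by (auto simp: v_def)
  have mv: "- v \<in> W" using W(4)[OF v(1), of "-1"] by simp
  have "cinner (T v) u = cinner v (T u)" using sa by (simp add: selfadjoint_def)
  then have sym: "Re (cinner (T v) u) = Re (cinner (T u) v)"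
    by (simp add: Re_cinner_commute)
  have Re: "Re (cinner (T u) v) = norm u * norm (T u)"
    using pos by (simp add: v_def cinner_scaleR_right Re_cinner_self power2_eq_square)
  have "4 * Re (cinner (T u) v) = Re (cinner (T (u + v)) (u + v)) - Re (cinner (T (u - v)) (u - v))"
    by (simp add: bounded_clinear_simps[OF T] cinner_add_left cinner_add_right cinner_diff_left
        cinner_diff_right sym)
  also have "\<dots> \<le> r * (norm (u + v))\<^sup>2 + r * (norm (u - v))\<^sup>2"
    using form[of "u + v"] form[of "u - v"] W(3)[OF W(1) v(1)] W(3)[OF W(1) mv] by auto
  also have "\<dots> = r * (4 * (norm u)\<^sup>2)"
    unfolding distrib_left[symmetric] by (simp add: power2_norm_add power2_norm_diff v(2))
  finally have "norm u * norm (T u) \<le> norm u * (r * norm u)"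
    by (simp add: Re power2_eq_square algebra_simps)
  then show ?thesis using pos by simp
qed

section \<open>Spectral measures of self-adjoint operators\<close>

locale selfadjoint_spectral_measure =
  fixes A :: "'a::complex_inner \<Rightarrow> 'a" and E :: "complex set \<Rightarrow> 'a \<Rightarrow> 'a"
  assumes A: "bounded_clinear A" and selfadjoint_A: "selfadjoint A"
    and spectral: "is_spectral_measure A E"
begin

abbreviation \<mu> :: "'a \<Rightarrow> complex measure" where "\<mu> \<equiv> scalar_measure E"

section \<open>Spectral projections and scalar measures\<close>

lemma pvm: "projection_valued_measure E"
  using spectral by (simp add: is_spectral_measure_def)

lemma E_bounded: "S \<in> sets borel \<Longrightarrow> bounded_clinear (E S)"
  and E_idem: "S \<in> sets borel \<Longrightarrow> E S (E S x) = E S x"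
  and E_adj: "S \<in> sets borel \<Longrightarrow> cinner (E S x) y = cinner x (E S y)"
  and E_empty: "E {} x = 0"
  and E_UNIV: "E UNIV x = x"
  and E_Int: "S \<in> sets borel \<Longrightarrow> S' \<in> sets borel \<Longrightarrow> E (S \<inter> S') x = E S (E S' x)"
  using pvm unfolding projection_valued_measure_def orthogonal_projection_def selfadjoint_def
  by (metis comp_apply id_apply)+

lemma E_sums:
  fixes F :: "nat \<Rightarrow> complex set"
  assumes "range F \<subseteq> sets borel" "disjoint_family F"
  shows "(\<lambda>n. E (F n) x) sums E (\<Union>n. F n) x"
  using pvm assms unfolding projection_valued_measure_def by blast

lemma E_form: "S \<in> sets borel \<Longrightarrow> cinner (E S f) f = of_real ((norm (E S f))\<^sup>2)"
  by (metis E_adj E_idem cinner_self)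

lemma E_Un_disjoint:
  assumes S: "S \<in> sets borel" and S': "S' \<in> sets borel" and disj: "S \<inter> S' = {}"
  shows "E (S \<union> S') x = E S x + E S' x"
proof -
  have "(\<lambda>n. E (binaryset S S' n) x) sums (E S x + E S' x)"
    by (rule binaryset_sums[where f = "\<lambda>S. E S x"]) (rule E_empty)
  moreover have "(\<lambda>n. E (binaryset S S' n) x) sums E (\<Union>n. binaryset S S' n) x"
    using S S' disj
    by (intro E_sums) (auto simp: binaryset_def disjoint_family_on_def)
  ultimately show ?thesis by (metis UN_binaryset_eq sums_unique2)
qed

lemma E_Compl: "S \<in> sets borel \<Longrightarrow> E (- S) x = x - E S x"
  using E_Un_disjoint[of S "- S" x] E_UNIV[of x] by (simp add: algebra_simps)

lemma sets_mu [simp, measurable_cong]: "sets (\<mu> f) = sets borel"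
  by (simp add: scalar_measure_def) (metis sets.sigma_sets_eq space_borel)

lemma space_mu [simp]: "space (\<mu> f) = UNIV"
  by (simp add: scalar_measure_def)

lemma emeasure_mu:
  assumes "S \<in> sets borel"
  shows "emeasure (\<mu> f) S = ennreal ((norm (E S f))\<^sup>2)"
proof -
  have "emeasure (\<mu> f) S = ennreal (Re (cinner (E S f) f))"
  proof (rule emeasure_measure_of[OF scalar_measure_def])
    show "positive (sets (\<mu> f)) (\<lambda>S. ennreal (Re (cinner (E S f) f)))"
      by (simp add: positive_def E_empty)
    show "countably_additive (sets (\<mu> f)) (\<lambda>S. ennreal (Re (cinner (E S f) f)))"
      unfolding countably_additive_def
    proof (intro allI impI)
      fix F :: "nat \<Rightarrow> complex set"
      assume F: "range F \<subseteq> sets (\<mu> f)" "disjoint_family F"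
      have "(\<lambda>n. Re (cinner (E (F n) f) f)) sums Re (cinner (E (\<Union>n. F n) f) f)"
        by (intro bounded_linear.sums[OF bounded_linear_Re]
            bounded_linear.sums[OF bounded_linear_cinner_left] E_sums) (use F in auto)
      then show "(\<Sum>n. ennreal (Re (cinner (E (F n) f) f))) = ennreal (Re (cinner (E (\<Union>n. F n) f) f))"
        using F by (intro suminf_ennreal_eq) (auto simp: E_form image_subset_iff)
    qed
  qed (use assms in auto)
  then show ?thesis using assms by (simp add: E_form)
qed

lemma measure_mu: "S \<in> sets borel \<Longrightarrow> measure (\<mu> f) S = (norm (E S f))\<^sup>2"
  by (simp add: measure_def emeasure_mu)

lemma finite_measure_mu: "finite_measure (\<mu> f)"
  by (rule finite_measureI) (simp add: emeasure_mu)

lemma AE_mu_iff: "S \<in> sets borel \<Longrightarrow> (AE z in \<mu> f. z \<in> S) \<longleftrightarrow> E (- S) f = 0"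
  by (subst AE_iff_measurable[where N = "- S"]) (auto simp: emeasure_mu)

text \<open>Multiplicativity of \<open>E\<close> turns projecting the vector into restricting its
  measure; integrals over \<open>S\<close> thereby become integrals against the measure of another
  vector.\<close>

lemma mu_E:
  assumes S: "S \<in> sets borel"
  shows "\<mu> (E S f) = density (\<mu> f) (\<lambda>z. ennreal (indicator S z))"
proof (rule measure_eqI)
  fix Q assume "Q \<in> sets (\<mu> (E S f))"
  then have Q: "Q \<in> sets borel" by simp
  have "emeasure (density (\<mu> f) (\<lambda>z. ennreal (indicator S z))) Q
      = (\<integral>\<^sup>+z. ennreal (indicator S z) * indicator Q z \<partial>\<mu> f)"
    using Q S by (intro emeasure_density) auto
  also have "\<dots> = (\<integral>\<^sup>+z. indicator (Q \<inter> S) z \<partial>\<mu> f)"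
    by (intro nn_integral_cong) (auto split: split_indicator)
  also have "\<dots> = emeasure (\<mu> f) (Q \<inter> S)"
    using Q S by simp
  finally show "emeasure (\<mu> (E S f)) Q = emeasure (density (\<mu> f) (\<lambda>z. ennreal (indicator S z))) Q"
    using Q S by (simp add: emeasure_mu E_Int)
qed simp

lemma integral_mu_E:
  fixes \<phi> :: "complex \<Rightarrow> 'b::{banach, second_countable_topology}"
  assumes "S \<in> sets borel" "\<phi> \<in> borel_measurable borel"
  shows "integral\<^sup>L (\<mu> (E S f)) \<phi> = (\<integral>z. indicator S z *\<^sub>R \<phi> z \<partial>\<mu> f)"
  unfolding mu_E[OF assms(1)] using assms
  by (intro integral_density) auto

text \<open>Integrability of the identity over the spectrum already includes measurability of its
  product with the indicator. That product vanishes at \<open>0\<close>, so it determines the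
  spectrum only up to this point, which is restored by hand.\<close>

lemma borel_spectrum: "op_spectrum A \<in> sets borel"
proof -
  let ?h = "\<lambda>z::complex. indicator (op_spectrum A) z *\<^sub>R z"
  have "integrable (\<mu> 0) ?h"
    using spectral
    unfolding is_spectral_measure_def has_spectral_integral_def set_integrable_def by blast
  then have "?h \<in> borel_measurable borel" by simp
  then have "?h -` (- {0}) \<inter> space borel \<in> sets borel"
    by (rule measurable_sets) simp
  moreover have "?h -` (- {0}) \<inter> space borel = op_spectrum A - {0}"
    by (auto split: split_indicator_asm)
  ultimately have "op_spectrum A - {0} \<in> sets borel" by simp
  moreover have "op_spectrum A = op_spectrum A - {0} \<or>
      op_spectrum A = (op_spectrum A - {0}) \<union> {0}" by auto
  ultimately show ?thesis
    by (metis sets.Un borel_singleton sets.empty_sets)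
qed

lemma AE_spectrum: "AE z in \<mu> f. z \<in> op_spectrum A"
proof -
  have "E (op_spectrum A) f = f"
    using spectral by (simp add: is_spectral_measure_def)
  then show ?thesis by (simp add: AE_mu_iff borel_spectrum E_Compl)
qed

lemma set_integral_spectrum:
  fixes \<phi> :: "complex \<Rightarrow> complex"
  assumes [measurable]: "\<phi> \<in> borel_measurable borel"
  shows "set_integrable (\<mu> f) (op_spectrum A) \<phi> \<longleftrightarrow> integrable (\<mu> f) \<phi>"
    and "(LINT z:op_spectrum A|\<mu> f. \<phi> z) = integral\<^sup>L (\<mu> f) \<phi>"
proof -
  note [measurable] = borel_spectrum
  have ae: "AE z in \<mu> f. indicator (op_spectrum A) z *\<^sub>R \<phi> z = \<phi> z"
    using AE_spectrum[of f] by eventually_elim simp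
  show "set_integrable (\<mu> f) (op_spectrum A) \<phi> \<longleftrightarrow> integrable (\<mu> f) \<phi>"
    unfolding set_integrable_def by (rule integrable_cong_AE) (use ae in auto)
  show "(LINT z:op_spectrum A|\<mu> f. \<phi> z) = integral\<^sup>L (\<mu> f) \<phi>"
    unfolding set_lebesgue_integral_def by (rule integral_cong_AE) (use ae in auto)
qed

lemma integrable_ident: "integrable (\<mu> f) (\<lambda>z. z)"
  and A_form: "cinner (A f) f = (\<integral>z. z \<partial>\<mu> f)"
  using spectral
  by (auto simp: is_spectral_measure_def has_spectral_integral_def set_integral_spectrum)

lemma integral_Re: "(\<integral>z. Re z \<partial>\<mu> f) = Re (cinner (A f) f)"
  by (simp add: A_form integrable_ident)

lemma cinner_A: "cinner (A x) y = cinner x (A y)"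
  using selfadjoint_A by (simp add: selfadjoint_def)

lemma integral_Im: "(\<integral>z. Im z \<partial>\<mu> f) = 0"
proof -
  have "(\<integral>z. Im z \<partial>\<mu> f) = Im (cinner (A f) f)"
    by (simp add: A_form integrable_ident)
  also have "\<dots> = 0"
    by (metis cinner_A cinner_commute cnj.simps(2) equal_neg_zero)
  finally show ?thesis .
qed

section \<open>Commutation of \<open>A\<close> with the spectral projections\<close>

lemma A_form_split:
  assumes S: "S \<in> sets borel"
  shows "cinner (A w) w = cinner (A (E S w)) (E S w) + cinner (A (E (- S) w)) (E (- S) w)"
proof -
  have "integrable (\<mu> w) (\<lambda>z. indicator Q z *\<^sub>R z)" if "Q \<in> sets borel" for Q
    using integrable_ident that by (intro integrable_mult_indicator) auto
  then have "(\<integral>z. z \<partial>\<mu> (E S w)) + (\<integral>z. z \<partial>\<mu> (E (- S) w))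
     = (\<integral>z. indicator S z *\<^sub>R z + indicator (- S) z *\<^sub>R z \<partial>\<mu> w)"
    using S by (simp add: integral_mu_E)
  also have "\<dots> = (\<integral>z. z \<partial>\<mu> w)"
    by (intro Bochner_Integration.integral_cong) (auto split: split_indicator)
  finally show ?thesis by (simp add: A_form)
qed

text \<open>By \<open>A_form_split\<close> the form of \<open>A\<close> at \<open>?u + ?v\<close>
  has no cross terms. Self-adjointness makes the two cross terms have equal real parts, so these
  vanish; replacing \<open>y\<close> by \<open>\<i> *\<^sub>C y\<close> handles the imaginary
  part.\<close>

lemma A_orthogonal:
  assumes S: "S \<in> sets borel"
  shows "cinner (A (E S x)) (E (- S) y) = 0"
proof -
  have S': "- S \<in> sets borel" using S by auto
  have Re0: "Re (cinner (A (E S x)) (E (- S) y)) = 0" for y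
  proof -
    let ?u = "E S x" and ?v = "E (- S) y"
    have "E S ?v = 0" "E (- S) ?u = 0"
      using E_Int[OF S S', of y] E_Int[OF S' S, of x] by (simp_all add: E_empty)
    then have "cinner (A (?u + ?v)) (?u + ?v) = cinner (A ?u) ?u + cinner (A ?v) ?v"
      using A_form_split[OF S, of "?u + ?v"]
      by (simp add: bounded_clinear_simps[OF E_bounded[OF S]]
          bounded_clinear_simps[OF E_bounded[OF S']] E_idem S S')
    then have "cinner (A ?u) ?v + cinner (A ?v) ?u = 0"
      by (simp add: bounded_clinear_simps[OF A] cinner_add_left cinner_add_right algebra_simps)
    moreover have "Re (cinner (A ?v) ?u) = Re (cinner (A ?u) ?v)"
      by (metis cinner_A Re_cinner_commute)
    ultimately show ?thesis
      by (simp add: complex_eq_iff)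
  qed
  show ?thesis
    using Re0[of y] Re0[of "\<i> *\<^sub>C y"]
    by (simp add: bounded_clinear_simps[OF E_bounded[OF S']] cinner_scaleC_right complex_eq_iff)
qed

text \<open>Orthogonality for \<open>S\<close> and for its complement says that \<open>A\<close>
  leaves both ranges invariant, which is commutation with the projection.\<close>

lemma A_E_commute:
  assumes S: "S \<in> sets borel"
  shows "A (E S x) = E S (A x)"
proof -
  have S': "- S \<in> sets borel" using S by auto
  have zero: "E (- S) (A (E S x)) = 0" if S: "S \<in> sets borel" for S
    by (rule eq_zero_if_cinner_zero) (use A_orthogonal[OF S] S in \<open>auto simp: E_adj\<close>)
  have "E S (A (x - E S x)) = 0"
    using zero[OF S'] by (simp add: E_Compl S)
  then have "E S (A x) = E S (A (E S x))"
    by (simp add: bounded_clinear_simps[OF A] bounded_clinear_simps[OF E_bounded[OF S]])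
  also have "\<dots> = A (E S x)"
    using zero[OF S] by (simp add: E_Compl S)
  finally show ?thesis by simp
qed

section \<open>Location of the support of the scalar measures\<close>

text \<open>The way to show that a region \<open>S\<close> carries no mass: the integral of
  \<open>h\<close> over \<open>S\<close> is both nonnegative and at most \<open>0\<close>, so
  \<open>h\<close> vanishes almost everywhere on \<open>S\<close>, where it is positive. The bound
  \<open>le\<close> will come from operator inequalities applied to \<open>E S f\<close>.\<close>

lemma E_zero_if_pos:
  fixes h :: "complex \<Rightarrow> real"
  assumes S: "S \<in> sets borel" and h: "integrable (\<mu> f) h" and pos: "\<And>z. z \<in> S \<Longrightarrow> h z > 0"
    and le: "integral\<^sup>L (\<mu> (E S f)) h \<le> 0"
  shows "E S f = 0"
proof -
  let ?g = "\<lambda>z. indicator S z *\<^sub>R h z"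
  have hm: "h \<in> borel_measurable borel" using borel_measurable_integrable[OF h] by simp
  have int: "integrable (\<mu> f) ?g"
    using h S by (intro integrable_mult_indicator) auto
  have nn: "?g z \<ge> 0" for z using pos[of z] by (auto split: split_indicator)
  have "integral\<^sup>L (\<mu> f) ?g = 0"
    using le nn by (simp add: integral_mu_E[OF S hm] order_antisym)
  then have "AE z in \<mu> f. ?g z = 0"
    using integral_nonneg_eq_0_iff_AE[OF int] nn by simp
  then have "AE z in \<mu> f. z \<in> - S"
    by eventually_elim (use pos in \<open>force split: split_indicator_asm\<close>)
  then show ?thesis using S by (subst (asm) AE_mu_iff) auto
qed

lemma integrable_const_mu: "integrable (\<mu> f) (\<lambda>_. c::real)"
  using finite_measure.integrable_const[OF finite_measure_mu] .

lemma measure_mu_UNIV [simp]: "measure (\<mu> f) UNIV = (norm f)\<^sup>2"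
  by (simp add: measure_mu E_UNIV)

text \<open>The form of \<open>A\<close> is real, so \<open>Im\<close> integrates to
  \<open>0\<close> against the measure of every vector, in particular of those projected to an open
  half-plane.\<close>

lemma AE_real: "AE z in \<mu> f. z \<in> \<real>"
proof -
  have "E {z. Im z > 0} f = 0"
    by (rule E_zero_if_pos[where h = Im]) (auto simp: integrable_ident integral_Im)
  moreover have "E {z. Im z < 0} f = 0"
    by (rule E_zero_if_pos[where h = "\<lambda>z. - Im z"]) (auto simp: integrable_ident integral_Im)
  ultimately have "AE z in \<mu> f. z \<in> - {z. Im z > 0}" "AE z in \<mu> f. z \<in> - {z. Im z < 0}"
    by (subst AE_mu_iff; simp)+
  then show ?thesis
    by eventually_elim (auto simp: complex_is_Real_iff)
qed

text \<open>On the vector projected to \<open>Re z > K\<close>, the integral of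
  \<open>Re z - K\<close> is at most \<open>0\<close> by Cauchy-Schwarz; the other side is
  symmetric.\<close>

lemma AE_bounded:
  assumes K: "\<And>x. norm (A x) \<le> K * norm x"
  shows "AE z in \<mu> f. \<bar>Re z\<bar> \<le> K"
proof -
  have le: "\<bar>Re (cinner (A g) g)\<bar> \<le> K * (norm g)\<^sup>2" for g
  proof -
    have "\<bar>Re (cinner (A g) g)\<bar> \<le> norm (A g) * norm g"
      using abs_Re_le_cmod cmod_cinner_le order_trans by blast
    also have "\<dots> \<le> K * norm g * norm g" by (intro mult_right_mono K) simp
    finally show ?thesis by (simp add: power2_eq_square)
  qed
  have "E {z. Re z > K} f = 0"
    by (rule E_zero_if_pos[where h = "\<lambda>z. Re z - K"])
       (use le[of "E {z. Re z > K} f"] in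
        \<open>auto simp: integrable_ident integrable_const_mu integral_Re mult.commute\<close>)
  moreover have "E {z. Re z < - K} f = 0"
    by (rule E_zero_if_pos[where h = "\<lambda>z. - K - Re z"])
       (use le[of "E {z. Re z < - K} f"] in
        \<open>auto simp: integrable_ident integrable_const_mu integral_Re mult.commute\<close>)
  ultimately have "AE z in \<mu> f. z \<in> - {z. Re z > K}" "AE z in \<mu> f. z \<in> - {z. Re z < - K}"
    by (subst AE_mu_iff; simp)+
  then show ?thesis
    by eventually_elim auto
qed

lemma integrable_bounded_mu:
  fixes \<phi> :: "complex \<Rightarrow> 'b::{banach, second_countable_topology}"
  shows "AE z in \<mu> f. norm (\<phi> z) \<le> B \<Longrightarrow> \<phi> \<in> borel_measurable borel \<Longrightarrow> integrable (\<mu> f) \<phi>"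
  by (rule finite_measure.integrable_const_bound[OF finite_measure_mu]) auto

lemma integrable_Re_power: "integrable (\<mu> f) (\<lambda>z. (Re z) ^ n)"
proof -
  obtain K where K: "K > 0" "\<And>x. norm (A x) \<le> K * norm x"
    using bounded_clinear_bound[OF A] by blast
  have "AE z in \<mu> f. norm ((Re z) ^ n) \<le> K ^ n"
    using AE_bounded[OF K(2)] by eventually_elim (auto simp: power_abs intro!: power_mono)
  then show ?thesis by (rule integrable_bounded_mu) simp
qed

section \<open>The second moment and the powers of \<open>A\<close>\<close>

text \<open>Replacing \<open>A\<close> by \<open>A - c\<close> and \<open>Re z\<close> by
  \<open>Re z - c\<close> changes both terms equally, since first moments agree. With
  \<open>c\<close> the midpoint of the strip and \<open>r\<close> its half-width, both shifted terms
  lie between \<open>0\<close> and \<open>r\<^sup>2 * (norm u)\<^sup>2\<close>.\<close>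

lemma strip_defect_le:
  fixes a b f
  defines "S \<equiv> {z. a \<le> Re z \<and> Re z < b}"
  shows "\<bar>(norm (A (E S f)))\<^sup>2 - (\<integral>z. (Re z)\<^sup>2 \<partial>\<mu> (E S f))\<bar> \<le> (b - a)\<^sup>2 * (norm (E S f))\<^sup>2"
proof (cases "a \<le> b")
  case False
  then have "S = {}" by (auto simp: S_def)
  then have "E S f = 0" by (simp add: E_empty)
  moreover have "(\<integral>z. (Re z)\<^sup>2 \<partial>\<mu> 0) = 0"
    using integral_mu_E[of "{}" "\<lambda>z. (Re z)\<^sup>2" 0] by (simp add: E_empty)
  ultimately show ?thesis by (simp add: bounded_clinear_simps[OF A])
next
  case True
  have S: "S \<in> sets borel" by (simp add: S_def)
  define c where "c = (a + b) / 2"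
  define r where "r = (b - a) / 2"
  define T where "T = (\<lambda>x. A x - c *\<^sub>R x)"
  define u where "u = E S f"
  obtain K where K: "\<And>x. norm (A x) \<le> K * norm x"
    using bounded_clinear_bound[OF A] by blast
  have T: "bounded_clinear T"
  proof (rule bounded_clinearI[where K = "K + \<bar>c\<bar>"])
    fix x show "norm (T x) \<le> (K + \<bar>c\<bar>) * norm x"
      unfolding T_def using norm_triangle_ineq4[of "A x" "c *\<^sub>R x"] K[of x] by (simp add: algebra_simps)
  qed (auto simp: T_def bounded_clinear_simps[OF A] algebra_simps scaleC_diff_right
        scaleC_add_right scaleR_scaleC scaleC_scaleC mult.commute)
  have Tsa: "selfadjoint T"
    by (auto simp: selfadjoint_def T_def cinner_diff_left cinner_diff_right cinner_A
        cinner_scaleR_left cinner_scaleR_right)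
  have range: "\<bar>Re z - c\<bar> \<le> r" if "z \<in> S" for z
    using that unfolding S_def c_def r_def by (auto simp: abs_le_iff field_simps)
  \<comment> \<open>For \<open>w\<close> fixed by \<open>E S\<close> the measure lives on the strip,
    so the form of \<open>T\<close> is bounded by the half-width there.\<close>
  have form: "\<bar>Re (cinner (T w) w)\<bar> \<le> r * (norm w)\<^sup>2" if w: "E S w = w" for w
  proof -
    have "Re (cinner (T w) w) = (\<integral>z. Re z - c \<partial>\<mu> w)"
      by (simp add: T_def integral_Re integrable_ident integrable_const_mu
          cinner_diff_left cinner_scaleR_left Re_cinner_self)
    moreover have "(\<integral>z. \<bar>Re z - c\<bar> \<partial>\<mu> w) \<le> (\<integral>z. r \<partial>\<mu> w)"
    proof (rule integral_mono_AE)
      show "AE z in \<mu> w. \<bar>Re z - c\<bar> \<le> r"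
        using AE_mu_iff[OF S, of w] w by (auto simp: E_Compl S range elim: eventually_mono)
    qed (simp_all add: integrable_ident integrable_const_mu)
    ultimately show ?thesis
      by (auto simp: mult.commute intro: order_trans[OF integral_abs_bound])
  qed
  have "norm (T u) \<le> r * norm u"
  proof (rule selfadjoint_norm_le_form[OF T Tsa, where W = "{w. E S w = w}"])
    show "T u \<in> {w. E S w = w}"
      by (simp add: T_def u_def bounded_clinear_simps[OF E_bounded[OF S]] E_idem S
          A_E_commute[OF S, symmetric])
  qed (auto simp: u_def E_idem S bounded_clinear_simps[OF E_bounded[OF S]] form)
  then have Tu: "(norm (T u))\<^sup>2 \<le> r\<^sup>2 * (norm u)\<^sup>2"
    using power_mono[of "norm (T u)" "r * norm u" 2] by (simp add: power_mult_distrib)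
  have Tu_eq: "(norm (T u))\<^sup>2 = (norm (A u))\<^sup>2 - 2 * c * Re (cinner (A u) u) + c\<^sup>2 * (norm u)\<^sup>2"
    by (simp add: T_def power2_norm_diff cinner_scaleR_right power_mult_distrib)
  have "(\<integral>z. (Re z - c)\<^sup>2 \<partial>\<mu> u) = (\<integral>z. (Re z)\<^sup>2 - 2 * c * Re z + c\<^sup>2 \<partial>\<mu> u)"
    by (simp add: power2_diff algebra_simps)
  also have "\<dots> = (\<integral>z. (Re z)\<^sup>2 \<partial>\<mu> u) - 2 * c * Re (cinner (A u) u) + c\<^sup>2 * (norm u)\<^sup>2"
    using integrable_Re_power[of u 2] integrable_ident[of u]
    by (simp add: integrable_const_mu integral_Re)
  finally have int_eq: "(norm (A u))\<^sup>2 - (\<integral>z. (Re z)\<^sup>2 \<partial>\<mu> u) = (norm (T u))\<^sup>2 - (\<integral>z. (Re z - c)\<^sup>2 \<partial>\<mu> u)"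
    by (simp add: Tu_eq)
  have "AE z in \<mu> u. (Re z - c)\<^sup>2 \<le> r\<^sup>2"
  proof -
    have "AE z in \<mu> u. z \<in> S"
      by (subst AE_mu_iff[OF S]) (simp add: E_Compl S u_def E_idem)
    then show ?thesis
    proof eventually_elim
      fix z assume "z \<in> S"
      then show "(Re z - c)\<^sup>2 \<le> r\<^sup>2"
        using power_mono[OF range, of z 2] by simp
    qed
  qed
  then have "(\<integral>z. (Re z - c)\<^sup>2 \<partial>\<mu> u) \<le> (\<integral>z. r\<^sup>2 \<partial>\<mu> u)"
    using integrable_Re_power[of u 2] integrable_ident[of u]
    by (intro integral_mono_AE) (auto simp: power2_diff integrable_const_mu)
  then have "(\<integral>z. (Re z - c)\<^sup>2 \<partial>\<mu> u) \<le> r\<^sup>2 * (norm u)\<^sup>2"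
    by (simp add: mult.commute)
  moreover have "(\<integral>z. (Re z - c)\<^sup>2 \<partial>\<mu> u) \<ge> 0" by simp
  moreover have "r\<^sup>2 * (norm u)\<^sup>2 \<le> (b - a)\<^sup>2 * (norm u)\<^sup>2"
    by (intro mult_right_mono) (auto simp: r_def power_divide)
  ultimately show ?thesis
    using Tu int_eq zero_le_power2[of "norm (T u)"] unfolding u_def[symmetric] by linarith
qed

text \<open>The defect is additive over disjoint sets, whereas the bound is quadratic in the width of
  the strip: halving the strip halves the bound.\<close>

lemma strip_defect_halving:
  fixes a b f
  defines "S \<equiv> {z. a \<le> Re z \<and> Re z < b}"
  shows "\<bar>(norm (A (E S f)))\<^sup>2 - (\<integral>z. (Re z)\<^sup>2 \<partial>\<mu> (E S f))\<bar> \<le> ((b - a) / 2 ^ n)\<^sup>2 * (norm (E S f))\<^sup>2"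
  unfolding S_def
proof (induction n arbitrary: a b)
  case 0
  show ?case using strip_defect_le[of a b f] by simp
next
  case (Suc n)
  show ?case
  proof (cases "a \<le> b")
    case False
    then have "{z. a \<le> Re z \<and> Re z < b} = {}" by auto
    then show ?thesis using Suc.IH[of a b] by (simp only: E_empty) simp
  next
    case True
    define c where "c = (a + b) / 2"
    define S where "S = (\<lambda>a b. {z. a \<le> Re z \<and> Re z < b})"
    define D where "D = (\<lambda>S. (norm (A (E S f)))\<^sup>2 - (\<integral>z. (Re z)\<^sup>2 \<partial>\<mu> (E S f)))"
    have meas: "S x y \<in> sets borel" for x y by (simp add: S_def)
    have c: "a \<le> c" "c \<le> b" "c - a = (b - a) / 2" "b - c = (b - a) / 2"
      using True by (auto simp: c_def field_simps)
    have un: "S a b = S a c \<union> S c b" and disj: "S a c \<inter> S c b = {}"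
      using c by (auto simp: S_def)
    have E_un: "E (S a b) f = E (S a c) f + E (S c b) f"
      unfolding un by (rule E_Un_disjoint[OF meas meas disj])
    \<comment> \<open>Orthogonality of the two halves, together with commutation, makes both squared
      norms additive.\<close>
    have orth: "cinner (E (S a c) x) (E (S c b) y) = 0" for x y
      using E_Int[OF meas meas, of a c c b y] by (simp add: E_adj meas disj E_empty)
    have "A (E (S a b) f) = E (S a c) (A f) + E (S c b) (A f)"
      by (simp add: E_un bounded_clinear_simps[OF A] A_E_commute[OF meas])
    then have nA: "(norm (A (E (S a b) f)))\<^sup>2 = (norm (A (E (S a c) f)))\<^sup>2 + (norm (A (E (S c b) f)))\<^sup>2"
      by (simp add: power2_norm_add orth A_E_commute[OF meas])
    have nE: "(norm (E (S a b) f))\<^sup>2 = (norm (E (S a c) f))\<^sup>2 + (norm (E (S c b) f))\<^sup>2"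
      by (simp add: power2_norm_add orth E_un)
    have "integrable (\<mu> f) (\<lambda>z. indicator (S x y) z *\<^sub>R (Re z)\<^sup>2)" for x y
      using integrable_Re_power[of f 2] meas by (intro integrable_mult_indicator) auto
    then have "(\<integral>z. (Re z)\<^sup>2 \<partial>\<mu> (E (S a c) f)) + (\<integral>z. (Re z)\<^sup>2 \<partial>\<mu> (E (S c b) f))
      = (\<integral>z. indicator (S a c) z *\<^sub>R (Re z)\<^sup>2 + indicator (S c b) z *\<^sub>R (Re z)\<^sup>2 \<partial>\<mu> f)"
      using meas by (simp add: integral_mu_E)
    also have "\<dots> = (\<integral>z. (Re z)\<^sup>2 \<partial>\<mu> (E (S a b) f))"
      unfolding integral_mu_E[OF meas, of "\<lambda>z. (Re z)\<^sup>2", simplified] using un disj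
      by (intro Bochner_Integration.integral_cong) (auto split: split_indicator)
    finally have D_un: "D (S a b) = D (S a c) + D (S c b)"
      by (simp add: D_def nA)
    have "\<bar>D (S a c)\<bar> + \<bar>D (S c b)\<bar>
      \<le> ((c - a) / 2 ^ n)\<^sup>2 * (norm (E (S a c) f))\<^sup>2 + ((b - c) / 2 ^ n)\<^sup>2 * (norm (E (S c b) f))\<^sup>2"
      using Suc.IH[of a c] Suc.IH[of c b] by (simp add: D_def S_def)
    also have "\<dots> = ((b - a) / 2 ^ Suc n)\<^sup>2 * (norm (E (S a b) f))\<^sup>2"
      by (simp add: c nE distrib_left)
    finally show ?thesis
      using D_un by (simp add: D_def S_def)
  qed
qed

text \<open>The spectral measure prescribes only the form of \<open>A\<close>; this is where the
  square of \<open>A\<close> becomes accessible. The defect on a strip carrying the whole measure of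
  \<open>f\<close> is at most a multiple of \<open>1 / 4 ^ n\<close> for every
  \<open>n\<close>.\<close>

lemma norm_A_eq: "(norm (A f))\<^sup>2 = (\<integral>z. (Re z)\<^sup>2 \<partial>\<mu> f)"
proof -
  obtain K where K: "K > 0" "\<And>x. norm (A x) \<le> K * norm x"
    using bounded_clinear_bound[OF A] by blast
  \<comment> \<open>Strips are half-open, so the right end is \<open>K + 1\<close> in order to
    include \<open>Re z = K\<close>.\<close>
  define S where "S = {z. - K \<le> Re z \<and> Re z < K + 1}"
  have S: "S \<in> sets borel" by (simp add: S_def)
  have "AE z in \<mu> f. z \<in> S"
    using AE_bounded[OF K(2), of f] by eventually_elim (auto simp: S_def)
  then have ES: "E S f = f"
    by (simp add: AE_mu_iff S E_Compl)
  let ?D = "\<bar>(norm (A f))\<^sup>2 - (\<integral>z. (Re z)\<^sup>2 \<partial>\<mu> f)\<bar>"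
  have "?D \<le> ((K + 1 - (- K)) / 2 ^ n)\<^sup>2 * (norm f)\<^sup>2" for n
    using strip_defect_halving[of "-K" "K + 1" f n] ES by (simp add: S_def)
  moreover have "(\<lambda>n. ((K + 1 - (- K)) / 2 ^ n)\<^sup>2 * (norm f)\<^sup>2) \<longlonglongrightarrow> 0\<^sup>2 * (norm f)\<^sup>2"
    by (intro tendsto_intros LIMSEQ_divide_realpow_zero) auto
  ultimately have "?D \<le> 0"
    by (intro LIMSEQ_le_const) auto
  then show ?thesis by simp
qed

text \<open>This is \<open>norm_A_eq\<close> at \<open>E Q f\<close> for all Borel sets
  \<open>Q\<close>, since \<open>A\<close> commutes with \<open>E Q\<close>.\<close>

lemma mu_A: "\<mu> (A f) = density (\<mu> f) (\<lambda>z. ennreal ((Re z)\<^sup>2))"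
proof (rule measure_eqI)
  fix Q assume "Q \<in> sets (\<mu> (A f))"
  then have Q: "Q \<in> sets borel" by simp
  have "emeasure (\<mu> (A f)) Q = ennreal (\<integral>z. (Re z)\<^sup>2 \<partial>\<mu> (E Q f))"
    using Q by (simp add: emeasure_mu A_E_commute[symmetric] norm_A_eq)
  also have "\<dots> = ennreal (\<integral>z. indicator Q z *\<^sub>R (Re z)\<^sup>2 \<partial>\<mu> f)"
    using Q by (simp add: integral_mu_E)
  also have "\<dots> = (\<integral>\<^sup>+z. ennreal (indicator Q z *\<^sub>R (Re z)\<^sup>2) \<partial>\<mu> f)"
    using integrable_Re_power[of f 2] Q
    by (intro nn_integral_eq_integral[symmetric] integrable_mult_indicator) auto
  also have "\<dots> = emeasure (density (\<mu> f) (\<lambda>z. ennreal ((Re z)\<^sup>2))) Q"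
    using Q by (subst emeasure_density) (auto intro!: nn_integral_cong split: split_indicator)
  finally show "emeasure (\<mu> (A f)) Q = emeasure (density (\<mu> f) (\<lambda>z. ennreal ((Re z)\<^sup>2))) Q" .
qed simp

lemma cinner_A_power: "cinner ((A ^^ n) x) y = cinner x ((A ^^ n) y)"
  by (induction n arbitrary: y) (auto simp: cinner_A simp flip: funpow_swap1)

text \<open>Induction in steps of two: self-adjointness moves one \<open>A\<close> to the right,
  leaving the form of \<open>A ^^ n\<close> at the vector \<open>A f\<close>, and
  \<open>mu_A\<close> supplies the factor \<open>(Re z)\<^sup>2\<close>.\<close>

lemma A_power_form: "cinner ((A ^^ n) f) f = of_real (\<integral>z. (Re z) ^ n \<partial>\<mu> f)"
proof (induction n arbitrary: f rule: induct_nat_012)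
  case 0
  show ?case by (simp add: cinner_self)
next
  case 1
  have "Im (cinner (A f) f) = 0"
    using integral_Im[of f] by (simp add: A_form integrable_ident)
  then show ?case by (simp add: integral_Re complex_eq_iff)
next
  case (ge2 n)
  have "cinner ((A ^^ Suc (Suc n)) f) f = cinner ((A ^^ n) (A f)) (A f)"
    by (simp add: cinner_A cinner_A_power flip: funpow_swap1)
  also have "\<dots> = of_real (\<integral>z. (Re z) ^ Suc (Suc n) \<partial>\<mu> f)"
    by (simp add: ge2.IH(1) mu_A integral_density power2_eq_square mult.assoc)
  finally show ?case .
qed

text \<open>The first moment cannot detect a gap around \<open>0\<close>, as positive and negative
  values may cancel. The second moment can: \<open>\<epsilon>\<^sup>2 - (Re z)\<^sup>2\<close> is
  positive inside the gap, while \<open>norm_A_eq\<close> makes its integral at most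
  \<open>0\<close>.\<close>

lemma AE_bounded_below:
  assumes eps: "\<And>x. \<epsilon> * norm x \<le> norm (A x)" and "\<epsilon> > 0"
  shows "AE z in \<mu> f. \<bar>Re z\<bar> \<ge> \<epsilon>"
proof -
  define S where "S = {z. \<bar>Re z\<bar> < \<epsilon>}"
  have S: "S \<in> sets borel" by (simp add: S_def)
  have "E S f = 0"
  proof (rule E_zero_if_pos[where h = "\<lambda>z. \<epsilon>\<^sup>2 - (Re z)\<^sup>2"])
    show "integral\<^sup>L (\<mu> (E S f)) (\<lambda>z. \<epsilon>\<^sup>2 - (Re z)\<^sup>2) \<le> 0"
      using power_mono[OF eps[of "E S f"], of 2] \<open>\<epsilon> > 0\<close> integrable_Re_power[of "E S f" 2]
      by (simp add: integrable_const_mu norm_A_eq[symmetric] power_mult_distrib mult.commute)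
    show "\<epsilon>\<^sup>2 - (Re z)\<^sup>2 > 0" if "z \<in> S" for z
      using that power_strict_mono[of "\<bar>Re z\<bar>" \<epsilon> 2] by (auto simp: S_def)
  qed (use S integrable_Re_power[of f 2] in \<open>auto simp: integrable_const_mu\<close>)
  then have "AE z in \<mu> f. z \<in> - S"
    using S by (subst AE_mu_iff) auto
  then show ?thesis by eventually_elim (auto simp: S_def)
qed

end

section \<open>Polynomial and continuous functional calculus\<close>

definition op_poly :: "('a::complex_inner \<Rightarrow> 'a) \<Rightarrow> complex poly \<Rightarrow> 'a \<Rightarrow> 'a" where
  "op_poly A p x = (\<Sum>i\<le>degree p. coeff p i *\<^sub>C (A ^^ i) x)"

lemma bounded_clinear_sum: "bounded_clinear T \<Longrightarrow> T (\<Sum>i\<in>I. f i) = (\<Sum>i\<in>I. T (f i))"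
  by (induction I rule: infinite_finite_induct) (auto simp: bounded_clinear_simps)

lemma op_poly_altdef:
  assumes "degree p \<le> n"
  shows "op_poly A p x = (\<Sum>i\<le>n. coeff p i *\<^sub>C (A ^^ i) x)"
  unfolding op_poly_def
  by (rule sum.mono_neutral_left) (use assms in \<open>auto simp: coeff_eq_0\<close>)

lemma op_poly_0 [simp]: "op_poly A 0 x = 0"
  by (simp add: op_poly_def)

lemma op_poly_pCons:
  assumes "bounded_clinear A"
  shows "op_poly A (pCons a p) x = a *\<^sub>C x + A (op_poly A p x)"
  by (subst op_poly_altdef[OF degree_pCons_le], subst sum.atMost_Suc_shift)
     (simp add: op_poly_def bounded_clinear_sum[OF assms] bounded_clinear_scaleC[OF assms])

lemma op_poly_add: "op_poly A (p + q) x = op_poly A p x + op_poly A q x"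
  using op_poly_altdef[of "p + q" "max (degree p) (degree q)" A x]
    op_poly_altdef[of p "max (degree p) (degree q)" A x]
    op_poly_altdef[of q "max (degree p) (degree q)" A x]
  by (simp add: degree_add_le scaleC_add_left sum.distrib)

lemma op_poly_smult: "op_poly A (smult c p) x = c *\<^sub>C op_poly A p x"
  using op_poly_altdef[of "smult c p" "degree p" A x]
  by (simp add: op_poly_def scaleC_sum_right scaleC_scaleC)

lemma op_poly_diff: "op_poly A (p - q) x = op_poly A p x - op_poly A q x"
  using op_poly_add[of A "p - q" q x] by simp

lemma op_poly_bounded: "bounded_clinear A \<Longrightarrow> bounded_clinear (op_poly A p)"
proof (induction p)
  case 0
  show ?case by (rule bounded_clinearI[where K = 0]) auto
next
  case (pCons a p)
  obtain K L where K: "\<And>x. norm (A x) \<le> K * norm x" "K > 0"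
    and L: "\<And>x. norm (op_poly A p x) \<le> L * norm x"
    using bounded_clinear_bound[OF pCons.prems]
      bounded_clinear_bound[OF pCons.IH[OF pCons.prems]] by metis
  note simps = op_poly_pCons[OF pCons.prems] bounded_clinear_simps[OF pCons.prems]
    bounded_clinear_simps[OF pCons.IH[OF pCons.prems]]
  show ?case
  proof (rule bounded_clinearI[where K = "cmod a + K * L"])
    fix x
    have "norm (A (op_poly A p x)) \<le> K * (L * norm x)"
      by (rule order_trans[OF K(1)]) (use K(2) L in \<open>auto intro: mult_left_mono\<close>)
    then show "norm (op_poly A (pCons a p) x) \<le> (cmod a + K * L) * norm x"
      unfolding simps using norm_triangle_ineq[of "a *\<^sub>C x" "A (op_poly A p x)"]
      by (simp add: norm_scaleC algebra_simps)
  qed (auto simp: simps scaleC_add_right scaleC_scaleC mult.commute)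
qed

lemma op_poly_commute:
  assumes A: "bounded_clinear A"
  shows "op_poly A p (A x) = A (op_poly A p x)"
  by (induction p arbitrary: x) (auto simp: op_poly_pCons A bounded_clinear_simps[OF A])

lemma op_poly_mult:
  assumes A: "bounded_clinear A"
  shows "op_poly A (p * q) x = op_poly A p (op_poly A q x)"
  by (induction p arbitrary: x)
     (auto simp: op_poly_pCons op_poly_add op_poly_smult mult_pCons_left A)

lemma op_poly_adjoint:
  assumes A: "bounded_clinear A" and sa: "selfadjoint A"
  shows "cinner (op_poly A p x) y = cinner x (op_poly A (map_poly cnj p) y)"
proof (induction p arbitrary: x y)
  case (pCons a p)
  have "cinner (A (op_poly A p x)) y = cinner (op_poly A p x) (A y)"
    using sa by (simp add: selfadjoint_def)
  then show ?case
    by (simp add: op_poly_pCons[OF A] map_poly_pCons cinner_add_left cinner_add_right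
        cinner_scaleC_left cinner_scaleC_right pCons.IH op_poly_commute[OF A])
qed simp

lemma poly_map_cnj_real: "z \<in> \<real> \<Longrightarrow> poly (map_poly cnj p) z = cnj (poly p z)"
  by (metis poly_cnj Reals_cnj_iff)

lemma bounded_linear_scaleC_right: "bounded_linear (\<lambda>x::'a::complex_inner. c *\<^sub>C x)"
  by (rule bounded_linear_intro[where K = "cmod c"])
     (auto simp: scaleC_add_right scaleR_scaleC scaleC_scaleC norm_scaleC mult.commute)

section \<open>Extension from polynomials to continuous functions\<close>

text \<open>The only analytic input is the bound of \<open>op_poly A p\<close> by the supremum of
  \<open>p\<close> on \<open>X\<close>. No spectral measure appears, so operators built here can be
  compared with integrals against any of them.\<close>

locale polynomial_calculus =
  fixes A :: "'a::chilbert_space \<Rightarrow> 'a" and X :: "complex set"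
  assumes A: "bounded_clinear A" and selfadjoint_A: "selfadjoint A"
    and compact_X: "compact X" and X_real: "X \<subseteq> \<real>"
    and op_poly_le: "\<And>p e f. (\<And>z. z \<in> X \<Longrightarrow> cmod (poly p z) \<le> e) \<Longrightarrow>
          norm (op_poly A p f) \<le> e * norm f"
begin

text \<open>Expresses that \<open>T\<close> is \<open>\<phi>\<close> applied to \<open>A\<close>.
  Quantifying over all polynomials and all errors, instead of fixing an approximating sequence, lets
  each later argument choose its own approximant.\<close>

definition represents :: "(complex \<Rightarrow> complex) \<Rightarrow> ('a \<Rightarrow> 'a) \<Rightarrow> bool" where
  "represents \<phi> T \<longleftrightarrow> bounded_clinear T \<and>
     (\<forall>p e f. (\<forall>z\<in>X. cmod (\<phi> z - poly p z) \<le> e) \<longrightarrow>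
        norm (T f - op_poly A p f) \<le> e * norm f)"

lemma polynomial_approx:
  assumes cont: "continuous_on X \<phi>" and "e > 0"
  obtains p where "\<And>z. z \<in> X \<Longrightarrow> cmod (\<phi> z - poly p z) \<le> e"
proof -
  have comp: "compact (Re ` X)"
    by (intro compact_continuous_image compact_X continuous_intros)
  have "complex_of_real ` Re ` X = X"
    using X_real by (force simp: image_image elim!: Reals_cases)
  then have cont': "continuous_on (Re ` X) (\<lambda>x. \<phi> (of_real x))"
    by (intro continuous_on_compose2[OF cont] continuous_intros) auto
  obtain g where g: "polynomial_function g"
    "\<And>x. x \<in> Re ` X \<Longrightarrow> norm (\<phi> (of_real x) - g x) < e"
    using Stone_Weierstrass_polynomial_function[OF comp cont' \<open>e > 0\<close>] by metis
  have "real_polynomial_function (Re \<circ> g)" "real_polynomial_function (Im \<circ> g)"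
    using g(1) unfolding polynomial_function_def
    by (auto intro: bounded_linear_Re bounded_linear_Im)
  then obtain a m b n where "Re \<circ> g = (\<lambda>x. \<Sum>i\<le>m. a i * x ^ i)" "Im \<circ> g = (\<lambda>x. \<Sum>i\<le>n. b i * x ^ i)"
    unfolding real_polynomial_function_iff_sum by blast
  then have ab: "Re (g x) = (\<Sum>i\<le>m. a i * x ^ i)" "Im (g x) = (\<Sum>i\<le>n. b i * x ^ i)" for x
    by (metis comp_apply)+
  define p where "p = (\<Sum>i\<le>m. monom (complex_of_real (a i)) i) +
      smult \<i> (\<Sum>i\<le>n. monom (complex_of_real (b i)) i)"
  have p: "poly p (of_real x) = g x" for x
    by (subst complex_eq) (simp add: p_def poly_sum poly_monom ab)
  show ?thesis
  proof
    fix z assume "z \<in> X"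
    then have "z = of_real (Re z)" "Re z \<in> Re ` X" using X_real by (auto elim!: Reals_cases)
    then show "cmod (\<phi> z - poly p z) \<le> e"
      using g(2)[of "Re z"] p[of "Re z"] by simp
  qed
qed

lemma op_poly_diff_le:
  assumes "\<And>z. z \<in> X \<Longrightarrow> cmod (poly p z - poly q z) \<le> e"
  shows "norm (op_poly A p f - op_poly A q f) \<le> e * norm f"
  using op_poly_le[of "p - q" e f] assms by (simp add: op_poly_diff)

text \<open>One good polynomial for each \<open>\<delta>\<close> is enough: a competitor
  \<open>q\<close> within \<open>e\<close> of \<open>\<phi>\<close> is within
  \<open>e + \<delta>\<close> of it on \<open>X\<close>, so \<open>T\<close> is within
  \<open>e + 2 * \<delta>\<close> of \<open>op_poly A q\<close>.\<close>

lemma representsI: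
  assumes T: "bounded_clinear T"
    and ap: "\<And>\<delta>. \<delta> > 0 \<Longrightarrow> \<exists>p. (\<forall>z\<in>X. cmod (\<phi> z - poly p z) \<le> \<delta>) \<and>
           (\<forall>f. norm (T f - op_poly A p f) \<le> \<delta> * norm f)"
  shows "represents \<phi> T"
  unfolding represents_def
proof (intro conjI allI impI T)
  fix q e f assume q: "\<forall>z\<in>X. cmod (\<phi> z - poly q z) \<le> e"
  have *: "norm (T f - op_poly A q f) \<le> (e + 2 * \<delta>) * norm f" if \<delta>: "\<delta> > 0" for \<delta>
  proof -
    obtain p where p: "\<forall>z\<in>X. cmod (\<phi> z - poly p z) \<le> \<delta>"
        "norm (T f - op_poly A p f) \<le> \<delta> * norm f"
      using ap[OF \<delta>] by blast
    have "cmod (poly p z - poly q z) \<le> e + \<delta>" if "z \<in> X" for z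
      using p(1) q that norm_triangle_ineq4[of "\<phi> z - poly q z" "\<phi> z - poly p z"]
      by fastforce
    then have "norm (op_poly A p f - op_poly A q f) \<le> (e + \<delta>) * norm f"
      by (rule op_poly_diff_le)
    then show ?thesis
      using p(2) norm_triangle_ineq[of "T f - op_poly A p f" "op_poly A p f - op_poly A q f"]
      by (simp add: algebra_simps)
  qed
  show "norm (T f - op_poly A q f) \<le> e * norm f"
  proof (rule field_le_epsilon)
    fix \<eta> :: real assume "\<eta> > 0"
    \<comment> \<open>The summand \<open>1\<close> keeps the denominator positive when
      \<open>f = 0\<close>.\<close>
    define \<delta> where "\<delta> = \<eta> / (2 * (norm f + 1))"
    have "2 * \<delta> * norm f \<le> \<eta>"
      using \<open>\<eta> > 0\<close> by (simp add: \<delta>_def field_simps add_pos_nonneg)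
    moreover have "\<delta> > 0" using \<open>\<eta> > 0\<close> by (simp add: \<delta>_def add_nonneg_pos)
    ultimately show "norm (T f - op_poly A q f) \<le> e * norm f + \<eta>"
      using *[of \<delta>] by (simp add: algebra_simps)
  qed
qed

lemma represents_poly: "represents (poly p) (op_poly A p)"
  unfolding represents_def
  by (auto intro: op_poly_bounded A op_poly_diff_le)

lemma represents_bounded: "represents \<phi> T \<Longrightarrow> bounded_clinear T"
  by (simp add: represents_def)

lemma representsD:
  "represents \<phi> T \<Longrightarrow> (\<And>z. z \<in> X \<Longrightarrow> cmod (\<phi> z - poly p z) \<le> e) \<Longrightarrow>
     norm (T f - op_poly A p f) \<le> e * norm f"
  by (simp add: represents_def)

text \<open>Uniform approximants on \<open>X\<close> yield operators that are Cauchy at every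
  vector, and completeness gives the limit. The explicit rate \<open>1 / Suc n\<close> survives the
  limit and verifies \<open>representsI\<close>.\<close>

lemma represents_exists:
  assumes cont: "continuous_on X \<phi>"
  obtains T where "represents \<phi> T"
proof -
  have "\<exists>p. \<forall>z\<in>X. cmod (\<phi> z - poly p z) \<le> 1 / Suc n" for n :: nat
    by (rule polynomial_approx[OF cont, of "1 / Suc n"]) auto
  then obtain p where p: "\<And>n z. z \<in> X \<Longrightarrow> cmod (\<phi> z - poly (p n) z) \<le> 1 / Suc n"
    by metis
  have pp: "norm (op_poly A (p m) f - op_poly A (p n) f) \<le> (1 / Suc m + 1 / Suc n) * norm f" for m n f
  proof (rule op_poly_diff_le)
    fix z assume "z \<in> X"
    then show "cmod (poly (p m) z - poly (p n) z) \<le> 1 / Suc m + 1 / Suc n"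
      using p[of z m] p[of z n] norm_triangle_ineq4[of "\<phi> z - poly (p n) z" "\<phi> z - poly (p m) z"]
      by simp
  qed
  have lim0: "(\<lambda>n. 1 / Suc n) \<longlonglongrightarrow> 0"
    using LIMSEQ_inverse_real_of_nat by (simp add: inverse_eq_divide)
  have "Cauchy (\<lambda>n. op_poly A (p n) f)" for f
  proof (rule metric_CauchyI)
    fix e :: real assume "e > 0"
    have "(\<lambda>n. (1 / Suc n) * norm f) \<longlonglongrightarrow> 0 * norm f"
      by (intro tendsto_intros lim0)
    then have "\<forall>\<^sub>F n in sequentially. (1 / Suc n) * norm f < e / 2"
      by (rule order_tendstoD(2)) (use \<open>e > 0\<close> in simp)
    then obtain N where N: "\<And>n. n \<ge> N \<Longrightarrow> (1 / Suc n) * norm f < e / 2"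
      unfolding eventually_sequentially by blast
    have "dist (op_poly A (p m) f) (op_poly A (p n) f) < e" if "m \<ge> N" "n \<ge> N" for m n
      using N[OF that(1)] N[OF that(2)] pp[of m f n]
      unfolding dist_norm distrib_right by linarith
    then show "\<exists>M. \<forall>m\<ge>M. \<forall>n\<ge>M. dist (op_poly A (p m) f) (op_poly A (p n) f) < e"
      by blast
  qed
  then have "\<forall>f. \<exists>y. (\<lambda>n. op_poly A (p n) f) \<longlonglongrightarrow> y"
    using Cauchy_convergent convergent_def by blast
  then obtain T where T: "\<And>f. (\<lambda>n. op_poly A (p n) f) \<longlonglongrightarrow> T f"
    by metis
  have err: "norm (T f - op_poly A (p n) f) \<le> 1 / Suc n * norm f" for n f
  proof (rule LIMSEQ_le)
    show "(\<lambda>m. norm (op_poly A (p m) f - op_poly A (p n) f)) \<longlonglongrightarrow> norm (T f - op_poly A (p n) f)"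
      by (intro tendsto_intros T)
    have "(\<lambda>m. (1 / Suc m + 1 / Suc n) * norm f) \<longlonglongrightarrow> (0 + 1 / Suc n) * norm f"
      by (intro tendsto_intros lim0)
    then show "(\<lambda>m. (1 / Suc m + 1 / Suc n) * norm f) \<longlonglongrightarrow> 1 / Suc n * norm f"
      by simp
  qed (use pp in blast)
  note P = op_poly_bounded[OF A]
  obtain K where K: "\<And>f. norm (op_poly A (p 0) f) \<le> K * norm f"
    using bounded_clinear_bound[OF P] by blast
  have "bounded_clinear T"
  proof (rule bounded_clinearI[where K = "1 + K"])
    fix x y c
    show "T (x + y) = T x + T y"
      using LIMSEQ_unique[OF T[of "x + y"]] tendsto_add[OF T[of x] T[of y]]
      by (simp add: bounded_clinear_simps[OF P])
    show "T (c *\<^sub>C x) = c *\<^sub>C T x"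
      using LIMSEQ_unique[OF T[of "c *\<^sub>C x"]]
        bounded_linear.tendsto[OF bounded_linear_scaleC_right T[of x], of c]
      by (simp add: bounded_clinear_simps[OF P])
    show "norm (T x) \<le> (1 + K) * norm x"
      using err[of x 0] K[of x] norm_triangle_sub[of "T x" "op_poly A (p 0) x"]
      by (simp add: algebra_simps)
  qed
  then have "represents \<phi> T"
  proof (rule representsI)
    fix \<delta> :: real assume "\<delta> > 0"
    then obtain n where n: "1 / Suc n < \<delta>" using nat_approx_posE by blast
    show "\<exists>p. (\<forall>z\<in>X. cmod (\<phi> z - poly p z) \<le> \<delta>) \<and> (\<forall>f. norm (T f - op_poly A p f) \<le> \<delta> * norm f)"
    proof (intro exI[of _ "p n"] conjI ballI allI)
      show "cmod (\<phi> z - poly (p n) z) \<le> \<delta>" if "z \<in> X" for z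
        using p[OF that, of n] n by linarith
      show "norm (T f - op_poly A (p n) f) \<le> \<delta> * norm f" for f
        by (rule order_trans[OF err mult_right_mono]) (use n in auto)
    qed
  qed
  then show ?thesis by (rule that)
qed

text \<open>A polynomial within \<open>\<delta>\<close> of \<open>\<phi>\<close> is within
  \<open>e + \<delta>\<close> of \<open>\<psi>\<close>, so it serves to compare both operators. The
  case \<open>e = 0\<close> gives uniqueness; positive \<open>e\<close> will give the Lipschitz
  bound of the group.\<close>

lemma represents_diff_le:
  assumes T: "represents \<phi> T" and S: "represents \<psi> S" and cont: "continuous_on X \<phi>"
    and le: "\<And>z. z \<in> X \<Longrightarrow> cmod (\<phi> z - \<psi> z) \<le> e"
  shows "norm (T f - S f) \<le> e * norm f"
proof (rule field_le_epsilon)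
  fix \<eta> :: real assume "\<eta> > 0"
  define \<delta> where "\<delta> = \<eta> / (2 * (norm f + 1))"
  have \<delta>: "2 * \<delta> * norm f \<le> \<eta>"
    using \<open>\<eta> > 0\<close> by (simp add: \<delta>_def field_simps add_pos_nonneg)
  have "\<delta> > 0" using \<open>\<eta> > 0\<close> by (simp add: \<delta>_def add_nonneg_pos)
  then obtain p where p: "\<And>z. z \<in> X \<Longrightarrow> cmod (\<phi> z - poly p z) \<le> \<delta>"
    using polynomial_approx[OF cont] by blast
  have "cmod (\<psi> z - poly p z) \<le> e + \<delta>" if "z \<in> X" for z
    using p[OF that] le[OF that] norm_triangle_ineq4[of "\<phi> z - poly p z" "\<phi> z - \<psi> z"] by simp
  then have "norm (S f - op_poly A p f) \<le> (e + \<delta>) * norm f"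
    by (rule representsD[OF S])
  moreover have "norm (T f - op_poly A p f) \<le> \<delta> * norm f"
    by (rule representsD[OF T p])
  ultimately show "norm (T f - S f) \<le> e * norm f + \<eta>"
    using \<delta> norm_triangle_ineq4[of "T f - op_poly A p f" "S f - op_poly A p f"]
    by (simp add: algebra_simps)
qed

lemma represents_unique:
  assumes "represents \<phi> T" "represents \<psi> S" "continuous_on X \<phi>" "\<And>z. z \<in> X \<Longrightarrow> \<phi> z = \<psi> z"
  shows "T = S"
proof
  fix f show "T f = S f"
    using represents_diff_le[OF assms(1-3), of 0 f] assms(4) by simp
qed

text \<open>The product of approximants of the factors approximates the product, and
  \<open>op_poly\<close> is multiplicative.\<close>

lemma represents_mult:
  assumes T: "represents \<phi> T" and S: "represents \<psi> S"
    and cont: "continuous_on X \<phi>" "continuous_on X \<psi>"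
  shows "represents (\<lambda>z. \<phi> z * \<psi> z) (\<lambda>x. T (S x))"
proof (rule representsI)
  show "bounded_clinear (\<lambda>x. T (S x))"
    using T S represents_bounded bounded_clinear_compose by blast
  fix \<delta> :: real assume "\<delta> > 0"
  obtain K where K: "K > 0" "\<And>x. norm (T x) \<le> K * norm x"
    using bounded_clinear_bound[OF represents_bounded[OF T]] by blast
  obtain M where M: "M > 0" "\<And>z. z \<in> X \<Longrightarrow> cmod (\<phi> z) \<le> M" "\<And>z. z \<in> X \<Longrightarrow> cmod (\<psi> z) \<le> M"
  proof -
    have "bounded (\<phi> ` X)" "bounded (\<psi> ` X)"
      using cont compact_X compact_continuous_image compact_imp_bounded by blast+
    then obtain M1 M2 where M12: "\<And>z. z \<in> X \<Longrightarrow> cmod (\<phi> z) \<le> M1" "\<And>z. z \<in> X \<Longrightarrow> cmod (\<psi> z) \<le> M2"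
      unfolding bounded_iff by blast
    show ?thesis
    proof
      show "\<bar>M1\<bar> + \<bar>M2\<bar> + 1 > 0" by linarith
      show "cmod (\<phi> z) \<le> \<bar>M1\<bar> + \<bar>M2\<bar> + 1" if "z \<in> X" for z
        using M12(1)[OF that] by linarith
      show "cmod (\<psi> z) \<le> \<bar>M1\<bar> + \<bar>M2\<bar> + 1" if "z \<in> X" for z
        using M12(2)[OF that] by linarith
    qed
  qed
  \<comment> \<open>\<open>B\<close> dominates both error factors below: \<open>2 * M + 1\<close>
    for the functions and \<open>K + M + 1\<close> for the operators. The bound
    \<open>d \<le> 1\<close> gives \<open>cmod (poly q z) \<le> M + 1\<close> on
    \<open>X\<close>.\<close>
  define B where "B = K + 2 * M + 1"
  define d where "d = min 1 (\<delta> / B)"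
  have B: "B > 0" using K M by (simp add: B_def)
  have d: "d > 0" "d \<le> 1" "B * d \<le> \<delta>"
    using \<open>\<delta> > 0\<close> B by (auto simp: d_def min_def field_simps)
  obtain p q where p: "\<And>z. z \<in> X \<Longrightarrow> cmod (\<phi> z - poly p z) \<le> d"
    and q: "\<And>z. z \<in> X \<Longrightarrow> cmod (\<psi> z - poly q z) \<le> d"
    using polynomial_approx[OF cont(1) d(1)] polynomial_approx[OF cont(2) d(1)] by metis
  have q_le: "cmod (poly q z) \<le> M + 1" if "z \<in> X" for z
    using M(3)[OF that] q[OF that] d(2) norm_triangle_ineq4[of "\<psi> z" "\<psi> z - poly q z"] by simp
  show "\<exists>p. (\<forall>z\<in>X. cmod (\<phi> z * \<psi> z - poly p z) \<le> \<delta>) \<and>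
      (\<forall>f. norm (T (S f) - op_poly A p f) \<le> \<delta> * norm f)"
  proof (intro exI[of _ "p * q"] conjI ballI allI)
    fix z assume z: "z \<in> X"
    have "cmod (\<phi> z * \<psi> z - poly (p * q) z) = cmod (\<phi> z * (\<psi> z - poly q z) + poly q z * (\<phi> z - poly p z))"
      by (simp add: algebra_simps)
    also have "\<dots> \<le> cmod (\<phi> z) * cmod (\<psi> z - poly q z) + cmod (poly q z) * cmod (\<phi> z - poly p z)"
      by (metis norm_mult norm_triangle_ineq)
    also have "\<dots> \<le> M * d + (M + 1) * d"
      using M q_le p q z d by (intro add_mono mult_mono) auto
    also have "\<dots> \<le> B * d"
      using K d(1) by (simp add: B_def algebra_simps)
    finally show "cmod (\<phi> z * \<psi> z - poly (p * q) z) \<le> \<delta>" using d(3) by linarith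
  next
    fix f
    let ?P = "op_poly A p" and ?Q = "op_poly A q"
    have "norm (T (S f) - op_poly A (p * q) f) = norm (T (S f - ?Q f) + (T (?Q f) - ?P (?Q f)))"
      by (simp add: op_poly_mult[OF A] bounded_clinear_simps[OF represents_bounded[OF T]])
    also have "\<dots> \<le> norm (T (S f - ?Q f)) + norm (T (?Q f) - ?P (?Q f))"
      by (rule norm_triangle_ineq)
    also have "\<dots> \<le> K * norm (S f - ?Q f) + d * norm (?Q f)"
      by (intro add_mono K representsD[OF T] p)
    also have "\<dots> \<le> K * (d * norm f) + d * ((M + 1) * norm f)"
      using K d(1) by (intro add_mono mult_left_mono representsD[OF S] q op_poly_le q_le) auto
    also have "\<dots> = (K + M + 1) * d * norm f" by (simp add: algebra_simps)
    also have "\<dots> \<le> B * d * norm f"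
      using M d(1) by (intro mult_right_mono) (auto simp: B_def)
    also have "\<dots> \<le> \<delta> * norm f" using d(3) by (rule mult_right_mono) simp
    finally show "norm (T (S f) - op_poly A (p * q) f) \<le> \<delta> * norm f" .
  qed
qed

text \<open>Conjugating the coefficients of \<open>p\<close> takes the adjoint of
  \<open>op_poly A p\<close>. As \<open>X\<close> is real, it also conjugates the values of
  \<open>p\<close> on \<open>X\<close>, so the new polynomial approximates the conjugate of
  \<open>\<phi>\<close>.\<close>

lemma represents_adjoint:
  assumes T: "represents \<phi> T" and S: "represents (\<lambda>z. cnj (\<phi> z)) S" and cont: "continuous_on X \<phi>"
  shows "cinner (T f) g = cinner f (S g)"
proof -
  have "cmod (cinner (T f) g - cinner f (S g)) \<le> 0"
  proof (rule field_le_epsilon)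
    fix \<eta> :: real assume "\<eta> > 0"
    define \<delta> where "\<delta> = \<eta> / (2 * (norm f * norm g + 1))"
    have \<delta>: "2 * \<delta> * (norm f * norm g) \<le> \<eta>"
      using \<open>\<eta> > 0\<close> by (simp add: \<delta>_def field_simps add_pos_nonneg)
    have "\<delta> > 0" using \<open>\<eta> > 0\<close> by (simp add: \<delta>_def add_nonneg_pos)
    then obtain p where p: "\<And>z. z \<in> X \<Longrightarrow> cmod (\<phi> z - poly p z) \<le> \<delta>"
      using polynomial_approx[OF cont] by blast
    let ?P = "op_poly A p" and ?P' = "op_poly A (map_poly cnj p)"
    have "norm (S g - ?P' g) \<le> \<delta> * norm g"
    proof (rule representsD[OF S])
      fix z assume z: "z \<in> X"
      then have "poly (map_poly cnj p) z = cnj (poly p z)"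
        using X_real poly_map_cnj_real by blast
      then have "cnj (\<phi> z) - poly (map_poly cnj p) z = cnj (\<phi> z - poly p z)"
        by (simp only: complex_cnj_diff)
      then show "cmod (cnj (\<phi> z) - poly (map_poly cnj p) z) \<le> \<delta>"
        using p[OF z] by (simp only: complex_mod_cnj)
    qed
    then have 1: "cmod (cinner f (S g - ?P' g)) \<le> norm f * (\<delta> * norm g)"
      by (meson cmod_cinner_le mult_left_mono norm_ge_zero order_trans)
    have "norm (T f - ?P f) \<le> \<delta> * norm f"
      by (rule representsD[OF T p])
    then have 2: "cmod (cinner (T f - ?P f) g) \<le> \<delta> * norm f * norm g"
      by (meson cmod_cinner_le mult_right_mono norm_ge_zero order_trans)
    have eq: "cinner (T f) g - cinner f (S g) = cinner (T f - ?P f) g - cinner f (S g - ?P' g)"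
      by (simp add: cinner_diff_left cinner_diff_right op_poly_adjoint[OF A selfadjoint_A])
    show "cmod (cinner (T f) g - cinner f (S g)) \<le> 0 + \<eta>"
      unfolding eq using 1 2 \<delta> norm_triangle_ineq4[of "cinner (T f - ?P f) g" "cinner f (S g - ?P' g)"]
      by (simp add: algebra_simps)
  qed
  then show ?thesis by simp
qed

end

section \<open>Spectral measures satisfy the polynomial norm bound\<close>

context selfadjoint_spectral_measure
begin

lemma integrable_poly: "integrable (\<mu> f) (poly p)"
proof -
  obtain K where K: "K > 0" "\<And>x. norm (A x) \<le> K * norm x"
    using bounded_clinear_bound[OF A] by blast
  have "bounded (poly p ` cball 0 K)"
    by (intro compact_imp_bounded compact_continuous_image continuous_intros compact_cball)
  then obtain B where B: "\<And>z. z \<in> cball 0 K \<Longrightarrow> cmod (poly p z) \<le> B"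
    unfolding bounded_iff by blast
  have "AE z in \<mu> f. norm (poly p z) \<le> B"
    using AE_bounded[OF K(2), of f] AE_real[of f]
    by eventually_elim (rule B, auto elim!: Reals_cases)
  then show ?thesis
    by (rule integrable_bounded_mu)
       (intro borel_measurable_continuous_onI continuous_intros)
qed

lemma op_poly_form: "cinner (op_poly A p f) f = (\<integral>z. poly p z \<partial>\<mu> f)"
proof -
  have [measurable]: "poly p \<in> borel_measurable borel"
    by (intro borel_measurable_continuous_onI continuous_intros)
  have "cinner (op_poly A p f) f = (\<Sum>i\<le>degree p. coeff p i * of_real (\<integral>z. (Re z) ^ i \<partial>\<mu> f))"
    by (simp add: op_poly_def cinner_sum_left cinner_scaleC_left A_power_form)
  also have "\<dots> = (\<integral>z. (\<Sum>i\<le>degree p. coeff p i * of_real ((Re z) ^ i)) \<partial>\<mu> f)"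
    using integrable_Re_power[of f]
    by (subst Bochner_Integration.integral_sum) (auto simp del: of_real_power)
  also have "\<dots> = (\<integral>z. poly p z \<partial>\<mu> f)"
  proof (rule integral_cong_AE)
    show "AE z in \<mu> f. (\<Sum>i\<le>degree p. coeff p i * of_real ((Re z) ^ i)) = poly p z"
      using AE_real[of f] by eventually_elim (auto simp: poly_altdef elim!: Reals_cases)
  qed measurable
  finally show ?thesis .
qed

text \<open>The squared norm is the form of the conjugated polynomial times \<open>p\<close>, and
  its integrand is the squared modulus of \<open>p\<close> because the measure is carried by the
  reals.\<close>

lemma norm_op_poly_le:
  assumes X: "AE z in \<mu> f. z \<in> X" and le: "\<And>z. z \<in> X \<Longrightarrow> cmod (poly p z) \<le> e"
  shows "norm (op_poly A p f) \<le> e * norm f"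
proof (cases "f = 0")
  case True
  then show ?thesis using bounded_clinear_zero[OF op_poly_bounded[OF A]] by simp
next
  case False
  \<comment> \<open>An empty \<open>X\<close> would put no constraint on the sign of
    \<open>e\<close>; for nonzero \<open>f\<close> the measure has positive mass, which rules it
    out.\<close>
  have "X \<noteq> {}"
  proof
    assume "X = {}"
    then have "E UNIV f = 0" using X AE_mu_iff[of "{}" f] by simp
    then show False using False by (simp add: E_UNIV)
  qed
  then have e: "e \<ge> 0" using le by (meson ex_in_conv norm_ge_zero order_trans)
  let ?p' = "map_poly cnj p"
  have "(norm (op_poly A p f))\<^sup>2 = Re (cinner (op_poly A (?p' * p) f) f)"
    by (subst Re_cinner_commute)
       (simp add: op_poly_mult[OF A] op_poly_adjoint[OF A selfadjoint_A, symmetric] Re_cinner_self)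
  also have "\<dots> = (\<integral>z. Re (poly (?p' * p) z) \<partial>\<mu> f)"
    by (simp add: op_poly_form integrable_poly del: poly_mult)
  also have "\<dots> \<le> (\<integral>z. e\<^sup>2 \<partial>\<mu> f)"
  proof (rule integral_mono_AE)
    show "AE z in \<mu> f. Re (poly (?p' * p) z) \<le> e\<^sup>2"
      using X AE_real[of f]
    proof eventually_elim
      case (elim z)
      have "Re (poly (?p' * p) z) = (cmod (poly p z))\<^sup>2"
        using poly_map_cnj_real[OF elim(2), of p]
        by (simp only: poly_mult cnj_mult_eq_cmod_power2 Re_complex_of_real flip: of_real_power)
      then show ?case using le[OF elim(1)] e by (simp add: power_mono)
    qed
  qed (use integrable_poly[of f "?p' * p"] in \<open>auto simp: integrable_const_mu simp del: poly_mult\<close>)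
  finally have "(norm (op_poly A p f))\<^sup>2 \<le> (e * norm f)\<^sup>2"
    by (simp add: power_mult_distrib mult.commute)
  then show ?thesis using e by (simp add: power2_le_iff_abs_le)
qed

end

section \<open>Real powers of an invertible self-adjoint operator\<close>

text \<open>The logarithm whose branch underlies \<open>cpow\<close>; the library's \<open>Ln\<close> differs from it on the
  negative half-line.\<close>

definition log_neg :: "complex \<Rightarrow> complex" where
  "log_neg z = of_real (ln (cmod z)) + \<i> * of_real (arg_neg z)"

lemma cpow_eq: "cpow z t = exp (of_real t * log_neg z)"
  by (simp add: cpow_def log_neg_def)

lemma cpow_add: "cpow z (s + t) = cpow z s * cpow z t"
  by (simp add: cpow_eq exp_add distrib_right)

section \<open>Measurability and continuity of the branch\<close>

lemma borel_measurable_arg_neg [measurable]: "arg_neg \<in> borel_measurable borel"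
proof -
  \<comment> \<open>\<open>Arg\<close> is continuous off the closed negative half-line, and
    \<open>arg_neg\<close> is constantly \<open>- pi\<close> on it except at \<open>0\<close>, where
    it is \<open>0\<close>; the second summand corrects this point.\<close>
  have eq: "arg_neg = (\<lambda>z. (if z \<in> - \<real>\<^sub>\<le>\<^sub>0 then Arg z else - pi) + (if z \<in> {0} then pi else 0))"
  proof
    fix z
    have "Arg z = (if z = 0 then 0 else pi)" if "z \<in> \<real>\<^sub>\<le>\<^sub>0"
    proof (cases "z = 0")
      case False
      then show ?thesis
        using that by (auto simp: complex_nonpos_Reals_iff complex_eq_iff Arg_eq_pi)
    qed (simp add: Arg_zero)
    moreover have "Arg z \<noteq> pi" if "z \<notin> \<real>\<^sub>\<le>\<^sub>0"
      using that by (auto simp: Arg_eq_pi complex_nonpos_Reals_iff)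
    ultimately show "arg_neg z = (if z \<in> - \<real>\<^sub>\<le>\<^sub>0 then Arg z else - pi) + (if z \<in> {0} then pi else 0)"
      by (auto simp: arg_neg_def)
  qed
  have 1: "(\<lambda>z. if z \<in> - \<real>\<^sub>\<le>\<^sub>0 then Arg z else - pi) \<in> borel_measurable borel"
    by (intro borel_measurable_continuous_on_if continuous_on_Arg continuous_intros)
       (auto intro: borel_open)
  have 2: "(\<lambda>z::complex. if z \<in> {0} then pi else 0) \<in> borel_measurable borel"
    by measurable
  show ?thesis
    unfolding eq by (rule borel_measurable_add[OF 1 2])
qed

lemma borel_measurable_cpow [measurable]: "(\<lambda>z. cpow z t) \<in> borel_measurable borel"
  unfolding cpow_def by measurable

text \<open>A compact set that carries every scalar measure once \<open>\<epsilon>\<close> is a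
  lower bound and \<open>K\<close> an upper bound for \<open>A\<close>. For positive
  \<open>\<epsilon>\<close> it splits into a positive and a negative part at positive
  distance.\<close>

definition real_annulus :: "real \<Rightarrow> real \<Rightarrow> complex set" where
  "real_annulus \<epsilon> K = of_real ` {x. \<epsilon> \<le> \<bar>x\<bar> \<and> \<bar>x\<bar> \<le> K}"

lemma compact_real_annulus: "compact (real_annulus \<epsilon> K)"
proof -
  have "{x. \<epsilon> \<le> \<bar>x\<bar> \<and> \<bar>x\<bar> \<le> K} = {-K..K} \<inter> {x. \<epsilon> \<le> \<bar>x\<bar>}" by auto
  moreover have "closed {x::real. \<epsilon> \<le> \<bar>x\<bar>}"
    by (intro closed_Collect_le continuous_intros)
  ultimately have "compact {x. \<epsilon> \<le> \<bar>x\<bar> \<and> \<bar>x\<bar> \<le> K}"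
    by (simp add: compact_Int_closed)
  then show ?thesis
    unfolding real_annulus_def by (intro compact_continuous_image continuous_intros)
qed

text \<open>The jump of the argument across the negative half-line is invisible inside the real
  line: on the annulus the argument is \<open>0\<close> or \<open>- pi\<close> according to the sign
  of \<open>Re z\<close>, which is locally constant there.\<close>

lemma continuous_on_log_neg:
  assumes "\<epsilon> > 0"
  shows "continuous_on (real_annulus \<epsilon> K) log_neg"
proof -
  have "continuous_on (real_annulus \<epsilon> K)
      (\<lambda>z. of_real (ln (cmod z)) + \<i> * of_real (- pi * (1 - Re z / \<bar>Re z\<bar>) / 2))"
    using assms by (intro continuous_intros) (auto simp: real_annulus_def)
  moreover have "log_neg z = of_real (ln (cmod z)) + \<i> * of_real (- pi * (1 - Re z / \<bar>Re z\<bar>) / 2)"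
    if "z \<in> real_annulus \<epsilon> K" for z
    using that assms by (auto simp: real_annulus_def log_neg_def arg_neg_def abs_if split: if_splits)
  ultimately show ?thesis by (simp cong: continuous_on_cong)
qed

lemma continuous_on_cpow: "\<epsilon> > 0 \<Longrightarrow> continuous_on (real_annulus \<epsilon> K) (\<lambda>z. cpow z t)"
  unfolding cpow_eq by (intro continuous_intros continuous_on_log_neg)

lemma cmod_exp_diff_one_le: "cmod (exp u - 1) \<le> cmod u * exp (cmod u)"
proof -
  have "cmod (exp u - exp 0) \<le> exp (cmod u) * cmod (u - 0)"
  proof (rule field_differentiable_bound[where S = "cball 0 (cmod u)"])
    show "(exp has_field_derivative exp z) (at z within cball 0 (cmod u))" for z :: complex
      by (rule DERIV_exp[THEN has_field_derivative_at_within])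
    show "cmod (exp z) \<le> exp (cmod u)" if "z \<in> cball 0 (cmod u)" for z
      using that norm_exp[of z] by (simp add: order_trans[OF norm_exp])
  qed auto
  then show ?thesis by (simp add: mult.commute)
qed

section \<open>Identification of \<open>op_power\<close> and its adjoint group\<close>

text \<open>Both sides are within \<open>\<delta> * (norm f)\<^sup>2\<close> of the corresponding
  expressions for an approximating polynomial, and these agree by
  \<open>op_poly_form\<close>.\<close>

lemma represents_form:
  assumes E: "selfadjoint_spectral_measure A E" and P: "polynomial_calculus A X"
    and X: "\<And>f. AE z in scalar_measure E f. z \<in> X"
    and T: "polynomial_calculus.represents A X \<phi> T"
    and cont: "continuous_on X \<phi>" and meas: "\<phi> \<in> borel_measurable borel"
  shows "integrable (scalar_measure E f) \<phi>" (is ?int)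
    and "cinner (T f) f = (\<integral>z. \<phi> z \<partial>scalar_measure E f)" (is ?form)
proof -
  interpret selfadjoint_spectral_measure A E by fact
  interpret polynomial_calculus A X by fact
  have "bounded (\<phi> ` X)"
    using cont compact_X compact_continuous_image compact_imp_bounded by blast
  then obtain B where B: "\<And>z. z \<in> X \<Longrightarrow> cmod (\<phi> z) \<le> B"
    unfolding bounded_iff by blast
  show int: ?int
    by (rule integrable_bounded_mu[OF _ meas, where B = B])
       (use X[of f] B in \<open>auto elim: eventually_mono\<close>)
  have "cmod (cinner (T f) f - (\<integral>z. \<phi> z \<partial>\<mu> f)) \<le> 0"
  proof (rule field_le_epsilon)
    fix \<eta> :: real assume "\<eta> > 0"
    define \<delta> where "\<delta> = \<eta> / (2 * ((norm f)\<^sup>2 + 1))"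
    have \<delta>: "2 * \<delta> * (norm f)\<^sup>2 \<le> \<eta>"
      using \<open>\<eta> > 0\<close> by (simp add: \<delta>_def field_simps add_pos_nonneg)
    have "\<delta> > 0" using \<open>\<eta> > 0\<close> by (simp add: \<delta>_def add_nonneg_pos)
    then obtain p where p: "\<And>z. z \<in> X \<Longrightarrow> cmod (\<phi> z - poly p z) \<le> \<delta>"
      using polynomial_approx[OF cont] by blast
    have "norm (T f - op_poly A p f) \<le> \<delta> * norm f"
      by (rule representsD[OF T p])
    then have 1: "cmod (cinner (T f - op_poly A p f) f) \<le> \<delta> * norm f * norm f"
      by (meson cmod_cinner_le mult_right_mono norm_ge_zero order_trans)
    have "cmod (\<integral>z. \<phi> z - poly p z \<partial>\<mu> f) \<le> (\<integral>z. \<delta> \<partial>\<mu> f)"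
    proof (rule order_trans[OF integral_norm_bound])
      show "(\<integral>z. cmod (\<phi> z - poly p z) \<partial>\<mu> f) \<le> (\<integral>z. \<delta> \<partial>\<mu> f)"
        using int integrable_poly[of f p] X[of f] p
        by (intro integral_mono_AE) (auto simp: integrable_const_mu elim: eventually_mono)
    qed
    then have 2: "cmod ((\<integral>z. \<phi> z \<partial>\<mu> f) - (\<integral>z. poly p z \<partial>\<mu> f)) \<le> \<delta> * (norm f)\<^sup>2"
      using int integrable_poly[of f p] by (simp add: mult.commute)
    have eq: "cinner (T f) f - (\<integral>z. \<phi> z \<partial>\<mu> f) =
        cinner (T f - op_poly A p f) f - ((\<integral>z. \<phi> z \<partial>\<mu> f) - (\<integral>z. poly p z \<partial>\<mu> f))"
      by (simp add: cinner_diff_left op_poly_form)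
    show "cmod (cinner (T f) f - (\<integral>z. \<phi> z \<partial>\<mu> f)) \<le> 0 + \<eta>"
      unfolding eq
      using 1 2 \<delta> norm_triangle_ineq4[of "cinner (T f - op_poly A p f) f"
          "(\<integral>z. \<phi> z \<partial>\<mu> f) - (\<integral>z. poly p z \<partial>\<mu> f)"]
      by (simp add: algebra_simps power2_eq_square)
  qed
  then show ?form by simp
qed

lemma op_invertible_bounded_below:
  assumes "op_invertible A"
  obtains \<epsilon> where "\<epsilon> > 0" "\<And>x. \<epsilon> * norm x \<le> norm (A x)"
proof -
  obtain B where B: "bounded_clinear B" "B (A x) = x" for x
    using assms unfolding op_invertible_def by (metis comp_apply id_apply)
  obtain K where K: "K > 0" "\<And>x. norm (B x) \<le> K * norm x"
    using bounded_clinear_bound[OF B(1)] by blast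
  show ?thesis
  proof
    show "1 / K > 0" using K by simp
    show "1 / K * norm x \<le> norm (A x)" for x
      using K(2)[of "A x"] K(1) by (simp add: B(2) field_simps)
  qed
qed

text \<open>The bounds \<open>\<epsilon>\<close> and \<open>K\<close> come from \<open>A\<close>
  alone, so one annulus serves all its spectral measures. The operator \<open>T\<close> representing
  \<open>cpow\<close> is therefore the integral against each of them, which settles both existence
  and uniqueness in the definite description.\<close>

lemma op_power_represents:
  fixes A :: "'a::chilbert_space \<Rightarrow> 'a"
  assumes A: "bounded_clinear A" and inv: "op_invertible A" and sa: "selfadjoint A"
    and ex: "is_spectral_measure A E"
  obtains \<epsilon> K where "\<epsilon> > 0" "polynomial_calculus A (real_annulus \<epsilon> K)"
    "\<And>t. polynomial_calculus.represents A (real_annulus \<epsilon> K) (\<lambda>z. cpow z t) (op_power A t)"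
proof -
  obtain K where K: "\<And>x. norm (A x) \<le> K * norm x"
    using bounded_clinear_bound[OF A] by blast
  obtain \<epsilon> where \<epsilon>: "\<epsilon> > 0" "\<And>x. \<epsilon> * norm x \<le> norm (A x)"
    using op_invertible_bounded_below[OF inv] by blast
  define X where "X = real_annulus \<epsilon> K"
  have loc: "selfadjoint_spectral_measure A E'" if "is_spectral_measure A E'" for E'
    using A sa that by unfold_locales
  have AE_X: "AE z in scalar_measure E' f. z \<in> X" if E': "is_spectral_measure A E'" for E' f
  proof -
    interpret selfadjoint_spectral_measure A E' by (rule loc[OF E'])
    show ?thesis
      using AE_real[of f] AE_bounded[OF K, of f] AE_bounded_below[OF \<epsilon>(2,1), of f]
      by eventually_elim (auto simp: X_def real_annulus_def elim!: Reals_cases)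
  qed
  have P: "polynomial_calculus A X"
  proof
    interpret selfadjoint_spectral_measure A E by (rule loc[OF ex])
    show "norm (op_poly A p f) \<le> e * norm f" if "\<And>z. z \<in> X \<Longrightarrow> cmod (poly p z) \<le> e" for p e f
      using AE_X[OF ex] that by (rule norm_op_poly_le)
    show "compact X" "X \<subseteq> \<real>"
      unfolding X_def by (auto simp: compact_real_annulus) (auto simp: real_annulus_def)
  qed (use A sa in auto)
  interpret polynomial_calculus A X by (rule P)
  have "represents (\<lambda>z. cpow z t) (op_power A t)" for t
  proof -
    have cont: "continuous_on X (\<lambda>z. cpow z t)"
      unfolding X_def by (rule continuous_on_cpow[OF \<epsilon>(1)])
    obtain T where T: "represents (\<lambda>z. cpow z t) T"
      using represents_exists[OF cont] by blast
    have form: "integrable (scalar_measure E' f) (\<lambda>z. cpow z t)"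
        "cinner (T f) f = (\<integral>z. cpow z t \<partial>scalar_measure E' f)"
      if "is_spectral_measure A E'" for E' f
      using represents_form[OF loc[OF that] P AE_X[OF that] T cont borel_measurable_cpow] by auto
    have "op_power A t = T"
      unfolding op_power_def
    proof (rule the_equality)
      interpret selfadjoint_spectral_measure A E by (rule loc[OF ex])
      have "has_spectral_integral E (op_spectrum A) (\<lambda>z. cpow z t) T"
        using form[OF ex] represents_bounded[OF T]
        by (simp add: has_spectral_integral_def set_integral_spectrum)
      then show "\<exists>E. is_spectral_measure A E \<and> has_spectral_integral E (op_spectrum A) (\<lambda>z. cpow z t) T"
        using ex by blast
    next
      \<comment> \<open>A competitor may come from another spectral measure \<open>E'\<close>; its
        form agrees with that of \<open>T\<close>, and the form determines the operator.\<close>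
      fix T' assume "\<exists>E. is_spectral_measure A E \<and> has_spectral_integral E (op_spectrum A) (\<lambda>z. cpow z t) T'"
      then obtain E' where E': "is_spectral_measure A E'"
        and T': "has_spectral_integral E' (op_spectrum A) (\<lambda>z. cpow z t) T'" by blast
      interpret selfadjoint_spectral_measure A E' by (rule loc[OF E'])
      have "bounded_clinear T'" "\<And>f. cinner (T' f) f = cinner (T f) f"
        using T' by (auto simp: has_spectral_integral_def set_integral_spectrum form[OF E'])
      then show "T' = T"
        using represents_bounded[OF T] by (intro bounded_clinear_eqI_form)
    qed
    then show ?thesis using T by simp
  qed
  then show ?thesis using that[OF \<epsilon>(1) P[unfolded X_def]] by (simp add: X_def)
qed

text \<open>\<open>U t\<close> represents the conjugate of \<open>cpow\<close>. The group law holds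
  pointwise on \<open>X\<close>, and the Lipschitz bound follows from
  \<open>\<bar>t\<bar> * B\<close> bounding the exponent, where \<open>B\<close> bounds
  \<open>log_neg\<close> on \<open>X\<close>.\<close>

lemma op_power_adjoint_group:
  fixes A :: "'a::chilbert_space \<Rightarrow> 'a"
  assumes A: "bounded_clinear A" and inv: "op_invertible A" and sa: "selfadjoint A"
    and ex: "is_spectral_measure A E"
  obtains U :: "real \<Rightarrow> 'a \<Rightarrow> 'a" and M :: real where
    "\<And>t. bounded_linear (U t)" "\<And>x. U 0 x = x" "\<And>s t x. U (s + t) x = U s (U t x)" "M \<ge> 0"
    "\<And>t x. \<bar>t\<bar> \<le> 1 \<Longrightarrow> norm (U t x - x) \<le> M * \<bar>t\<bar> * norm x"
    "\<And>f t g. cinner f (op_power A t g) = cinner (U t f) g"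
proof -
  obtain \<epsilon> K where \<epsilon>: "\<epsilon> > 0" and P: "polynomial_calculus A (real_annulus \<epsilon> K)"
    and R: "\<And>t. polynomial_calculus.represents A (real_annulus \<epsilon> K) (\<lambda>z. cpow z t) (op_power A t)"
    using op_power_represents[OF assms] by blast
  define X where "X = real_annulus \<epsilon> K"
  interpret polynomial_calculus A X unfolding X_def by (rule P)
  have cont: "continuous_on X (\<lambda>z. cnj (cpow z t))" for t
    unfolding X_def by (intro continuous_intros continuous_on_cpow \<epsilon>)
  have "\<exists>T. represents (\<lambda>z. cnj (cpow z t)) T" for t
    using represents_exists[OF cont] by blast
  then obtain U where U: "\<And>t. represents (\<lambda>z. cnj (cpow z t)) (U t)" by metis
  have "bounded (log_neg ` X)"
    using continuous_on_log_neg[OF \<epsilon>, of K] compact_X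
    unfolding X_def by (intro compact_imp_bounded compact_continuous_image)
  then obtain B where B: "B > 0" "\<And>z. z \<in> X \<Longrightarrow> cmod (log_neg z) \<le> B"
    unfolding bounded_pos by blast
  have one: "represents (\<lambda>z. 1) (\<lambda>x. x)"
  proof -
    have "poly [:1::complex:] = (\<lambda>z. 1)" by auto
    moreover have "op_poly A [:1:] = (\<lambda>x. x)" by (auto simp: op_poly_def)
    ultimately show ?thesis using represents_poly[of "[:1:]"] by simp
  qed
  show ?thesis
  proof
    show "bounded_linear (U t)" for t
      by (intro bounded_clinear_bounded_linear represents_bounded[OF U])
    have "U 0 = (\<lambda>x. x)"
      by (rule represents_unique[OF U one cont]) (simp add: cpow_eq)
    then show "U 0 x = x" for x by simp
    have "U (s + t) = (\<lambda>x. U s (U t x))" for s t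
      by (rule represents_unique[OF U represents_mult[OF U U cont cont] cont]) (simp add: cpow_add)
    then show "U (s + t) x = U s (U t x)" for s t x by simp
    show "B * exp B \<ge> 0" using B by simp
    show "norm (U t x - x) \<le> B * exp B * \<bar>t\<bar> * norm x" if "\<bar>t\<bar> \<le> 1" for t x
    proof (rule represents_diff_le[OF U one cont])
      fix z assume z: "z \<in> X"
      have u: "cmod (of_real t * log_neg z) \<le> \<bar>t\<bar> * B"
        using B(2)[OF z] by (simp add: norm_mult mult_left_mono)
      also have "\<bar>t\<bar> * B \<le> B" using B(1) that by simp
      finally have u1: "cmod (of_real t * log_neg z) \<le> B" .
      have "cmod (cnj (cpow z t) - 1) = cmod (cpow z t - 1)"
        by (metis complex_cnj_diff complex_cnj_one complex_mod_cnj)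
      also have "\<dots> \<le> cmod (of_real t * log_neg z) * exp (cmod (of_real t * log_neg z))"
        unfolding cpow_eq by (rule cmod_exp_diff_one_le)
      also have "\<dots> \<le> \<bar>t\<bar> * B * exp B"
        using u u1 B(1) by (intro mult_mono) auto
      finally show "cmod (cnj (cpow z t) - 1) \<le> B * exp B * \<bar>t\<bar>" by (simp add: mult_ac)
    qed
    show "cinner f (op_power A t g) = cinner (U t f) g" for f t g
      by (rule represents_adjoint[OF U _ cont, symmetric]) (use R[of t] in \<open>simp add: X_def\<close>)
  qed
qed

section \<open>Observation over short times\<close>

text \<open>\<open>Q d x\<close> abstracts the energy observed along the orbit of \<open>x\<close>
  during the times from \<open>0\<close> to \<open>d\<close>: \<open>Q_plus\<close> and
  \<open>Q_scaleR\<close> are what remains of its being a quadratic form, and \<open>Q_split\<close>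
  restarts the observation at time \<open>a\<close>.\<close>

locale observed_semigroup =
  fixes U :: "real \<Rightarrow> 'a::real_normed_vector \<Rightarrow> 'a" and M :: real
    and Q :: "real \<Rightarrow> 'a \<Rightarrow> real" and C :: real
  assumes U_linear: "bounded_linear (U t)" and U_0: "U 0 x = x"
    and U_add: "U (s + t) x = U s (U t x)"
    and M_nonneg: "M \<ge> 0"
    and U_lipschitz: "0 \<le> h \<Longrightarrow> h \<le> 1 \<Longrightarrow> norm (U h x - x) \<le> M * h * norm x"
    and Q_nonneg: "Q d x \<ge> 0"
    and Q_plus: "d \<ge> 0 \<Longrightarrow> Q d (x + y) \<le> 2 * Q d x + 2 * Q d y"
    and Q_scaleR: "d \<ge> 0 \<Longrightarrow> Q d (r *\<^sub>R x) = r\<^sup>2 * Q d x"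
    and Q_split: "a \<ge> 0 \<Longrightarrow> b \<ge> 0 \<Longrightarrow> Q (a + b) x = Q a x + Q b (U a x)"
    and C_nonneg: "C \<ge> 0" and Q_le: "Q 1 x \<le> C * (norm x)\<^sup>2"
begin

definition D :: "real \<Rightarrow> 'a \<Rightarrow> 'a" where "D h x = U h x - x"

lemma U_eq: "U h x = x + D h x" by (simp add: D_def)

lemma D_linear: "bounded_linear (D h)"
  unfolding D_def[abs_def] by (intro bounded_linear_sub U_linear bounded_linear_ident)

lemma Q_mono: "0 \<le> a \<Longrightarrow> a \<le> b \<Longrightarrow> Q a x \<le> Q b x"
  using Q_split[of a "b - a" x] Q_nonneg[of "b - a" "U a x"] by simp

lemma Q_shift: "0 \<le> a \<Longrightarrow> 0 \<le> h \<Longrightarrow> Q a (U h x) \<le> Q (a + h) x"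
  using Q_split[of h a x] Q_nonneg[of h x] by (simp add: add.commute)

text \<open>Each application of \<open>D h\<close> costs a factor \<open>4\<close> and an additional
  observation time \<open>h\<close>.\<close>

lemma Q_D_power_le: "0 \<le> d \<Longrightarrow> 0 \<le> h \<Longrightarrow> Q d ((D h ^^ k) x) \<le> 4 ^ k * Q (d + real k * h) x"
proof (induction k arbitrary: d)
  case (Suc k)
  let ?y = "(D h ^^ k) x"
  have "Q d (D h ?y) \<le> 2 * Q d (U h ?y) + 2 * Q d (- ?y)"
    using Q_plus[of d "U h ?y" "- ?y"] Suc.prems by (simp add: D_def)
  also have "Q d (- ?y) = Q d ?y"
    using Q_scaleR[of d "-1" ?y] Suc.prems by simp
  also have "2 * Q d (U h ?y) + 2 * Q d ?y \<le> 4 * Q (d + h) ?y"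
    using Q_shift[of d h ?y] Q_mono[of d "d + h" ?y] Suc.prems by simp
  also have "\<dots> \<le> 4 * (4 ^ k * Q (d + h + real k * h) x)"
    using Suc.IH[of "d + h"] Suc.prems by simp
  finally show ?case by (simp add: algebra_simps)
qed simp

lemma norm_D_power_le:
  assumes "0 \<le> h" "h \<le> 1"
  shows "norm ((D h ^^ k) x) \<le> (M * h) ^ k * norm x"
proof (induction k)
  case (Suc k)
  have "norm (D h ((D h ^^ k) x)) \<le> M * h * norm ((D h ^^ k) x)"
    unfolding D_def[of h "(D h ^^ k) x"] by (rule U_lipschitz[OF assms])
  also have "\<dots> \<le> M * h * ((M * h) ^ k * norm x)"
    using Suc.IH assms M_nonneg by (intro mult_left_mono) auto
  finally show ?case by (simp add: mult_ac)
qed simp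

text \<open>The binomial expansion of the \<open>N\<close>-th power of \<open>U h = 1 + D h\<close>,
  by induction with Pascal's rule.\<close>

lemma U_binomial: "U (real N * h) x = (\<Sum>k\<le>N. real (N choose k) *\<^sub>R (D h ^^ k) x)"
proof (induction N)
  case 0
  show ?case by (simp add: U_0)
next
  case (Suc N)
  let ?d = "\<lambda>k. (D h ^^ k) x"
  have "U (real (Suc N) * h) x = U h (U (real N * h) x)"
    by (simp add: distrib_right flip: U_add)
  also have "\<dots> = (\<Sum>k\<le>N. real (N choose k) *\<^sub>R ?d k) + (\<Sum>k\<le>N. real (N choose k) *\<^sub>R ?d (Suc k))"
  proof -
    have "D h (\<Sum>k\<le>N. real (N choose k) *\<^sub>R ?d k) = (\<Sum>k\<le>N. real (N choose k) *\<^sub>R D h (?d k))"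
      by (simp only: linear_sum[OF D_linear[THEN bounded_linear.linear]]
          linear_scale[OF D_linear[THEN bounded_linear.linear]])
    then show ?thesis unfolding Suc.IH U_eq[of h] by simp
  qed
  also have "(\<Sum>k\<le>N. real (N choose k) *\<^sub>R ?d k) = (\<Sum>k\<le>Suc N. real (N choose k) *\<^sub>R ?d k)"
    by simp
  also have "\<dots> = x + (\<Sum>k\<le>N. real (N choose Suc k) *\<^sub>R ?d (Suc k))"
    by (subst sum.atMost_Suc_shift) simp
  also have "\<dots> + (\<Sum>k\<le>N. real (N choose k) *\<^sub>R ?d (Suc k))
      = x + (\<Sum>k\<le>N. real (Suc N choose Suc k) *\<^sub>R ?d (Suc k))"
    by (simp add: sum.distrib scaleR_add_left add_ac)
  also have "\<dots> = (\<Sum>k\<le>Suc N. real (Suc N choose k) *\<^sub>R ?d k)"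
    by (subst sum.atMost_Suc_shift) simp
  finally show ?case .
qed

text \<open>Truncating the expansion after \<open>K\<close> terms leaves only differences observable
  before time \<open>L\<close>. The constant depends on \<open>K\<close> and the coefficients but
  not on \<open>x\<close>.\<close>

lemma Q_newton_le:
  assumes "0 \<le> d" "0 \<le> h" and K: "d + real K * h \<le> L"
  shows "\<exists>B\<ge>0. \<forall>x. Q d (\<Sum>k<K. c k *\<^sub>R (D h ^^ k) x) \<le> B * Q L x"
  using K
proof (induction K)
  case 0
  have "Q d 0 = 0" using Q_scaleR[of d 0 0] assms by simp
  then show ?case by (intro exI[of _ 0]) simp
next
  case (Suc K)
  have "d + real K * h \<le> L" using Suc.prems \<open>0 \<le> h\<close> by (simp add: algebra_simps)
  then obtain B where B: "B \<ge> 0" "\<And>x. Q d (\<Sum>k<K. c k *\<^sub>R (D h ^^ k) x) \<le> B * Q L x"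
    using Suc.IH by blast
  show ?case
  proof (intro exI[of _ "2 * B + 2 * ((c K)\<^sup>2 * 4 ^ K)"] conjI allI)
    fix x
    have "Q d ((D h ^^ K) x) \<le> 4 ^ K * Q (d + real K * h) x"
      by (rule Q_D_power_le) (use assms in auto)
    also have "\<dots> \<le> 4 ^ K * Q L x"
      using assms \<open>d + real K * h \<le> L\<close> by (intro mult_left_mono Q_mono) auto
    finally have "Q d (c K *\<^sub>R (D h ^^ K) x) \<le> (c K)\<^sup>2 * (4 ^ K * Q L x)"
      using assms by (simp add: Q_scaleR mult_left_mono)
    then show "Q d (\<Sum>k<Suc K. c k *\<^sub>R (D h ^^ k) x) \<le> (2 * B + 2 * ((c K)\<^sup>2 * 4 ^ K)) * Q L x"
      using Q_plus[of d "\<Sum>k<K. c k *\<^sub>R (D h ^^ k) x" "c K *\<^sub>R (D h ^^ K) x"] B(2)[of x] assms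
      by (simp add: algebra_simps)
  qed (use B in simp)
qed

text \<open>Energy in a window starting at a possibly late time \<open>s\<close> is recovered from
  the window of length \<open>L\<close>: the truncated expansion \<open>?P\<close> gives the
  multiple of \<open>Q L x\<close>, the remainder \<open>?R\<close> the small error.\<close>

lemma Q_translate_le:
  assumes L: "0 < L" "L \<le> 1" and s: "0 \<le> s" and \<eta>: "\<eta> > 0"
  shows "\<exists>B\<ge>0. \<forall>x. Q (L / 2) (U s x) \<le> B * Q L x + \<eta> * (norm x)\<^sup>2"
proof -
  \<comment> \<open>Chosen so that a remainder of norm at most \<open>e * norm x\<close> contributes
    at most \<open>\<eta> * (norm x)\<^sup>2\<close> after the factor \<open>2\<close> of
    \<open>Q_plus\<close>; \<open>C + 1\<close> keeps the denominator positive.\<close>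
  define e where "e = sqrt (\<eta> / (2 * (C + 1)))"
  have e: "e > 0" "2 * (C * e\<^sup>2) \<le> \<eta>"
    using \<eta> C_nonneg by (auto simp: e_def field_simps)
  have "summable (\<lambda>n. inverse (fact n) * (M * s) ^ n)" by (rule summable_exp)
  \<comment> \<open>\<open>K\<close> depends only on \<open>M * s\<close> and \<open>e\<close>, so
    it is fixed before the step size \<open>h\<close> is chosen.\<close>
  then obtain K where K: "\<And>m n. m \<ge> K \<Longrightarrow> norm (\<Sum>k=m..<n. inverse (fact k) * (M * s) ^ k) < e"
    unfolding summable_Cauchy using e(1) by blast
  \<comment> \<open>The summands ensure in turn \<open>real K * h \<le> L / 2\<close>,
    \<open>h \<le> 1\<close>, \<open>K \<le> N\<close> and \<open>N > 0\<close>.\<close>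
  obtain N0 :: nat where N0: "real K * s / (L / 2) + s + real K + 1 \<le> real N0"
    using real_arch_simple by blast
  define N where "N = N0"
  have KsL: "real K * s / (L / 2) \<ge> 0" using s L by simp
  have N: "real K * s / (L / 2) \<le> real N" "s \<le> real N" "K \<le> N" "N > 0"
    using N0 s KsL unfolding N_def by linarith+
  define h where "h = s / real N"
  have h: "0 \<le> h" "h \<le> 1" "real N * h = s" "L / 2 + real K * h \<le> L"
    using N s L by (auto simp: h_def field_simps)
  let ?P = "\<lambda>x. \<Sum>k<K. real (N choose k) *\<^sub>R (D h ^^ k) x"
  let ?R = "\<lambda>x. \<Sum>k=K..<Suc N. real (N choose k) *\<^sub>R (D h ^^ k) x"
  have split: "U s x = ?P x + ?R x" for x
  proof -
    have "{..N} = {..<K} \<union> {K..<Suc N}" using N by auto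
    then show ?thesis
      unfolding h(3)[symmetric] U_binomial by (simp add: sum.union_disjoint ivl_disj_int)
  qed
  have R: "norm (?R x) \<le> e * norm x" for x
  proof -
    have "norm (?R x) \<le> (\<Sum>k=K..<Suc N. inverse (fact k) * (M * s) ^ k * norm x)"
    proof (rule sum_norm_le)
      fix k
      \<comment> \<open>Bounding the binomial coefficient by \<open>N ^ k / fact k\<close> combines
        with \<open>real N * h = s\<close> into a term of the exponential series that is free of
        \<open>N\<close>.\<close>
      have "real (N choose k) * fact k \<le> real N ^ k"
        using binomial_fact_pow[of N k] by (metis of_nat_fact of_nat_le_iff of_nat_mult of_nat_power)
      then have "real (N choose k) \<le> inverse (fact k) * real N ^ k"
        by (simp add: field_simps)
      then have "norm (real (N choose k) *\<^sub>R (D h ^^ k) x) \<le>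
          inverse (fact k) * real N ^ k * ((M * h) ^ k * norm x)"
        using norm_D_power_le[OF h(1,2), of k x]
        by (simp add: mult_mono)
      also have "\<dots> = inverse (fact k) * (M * (real N * h)) ^ k * norm x"
        by (simp add: power_mult_distrib mult_ac)
      finally show "norm (real (N choose k) *\<^sub>R (D h ^^ k) x) \<le> inverse (fact k) * (M * s) ^ k * norm x"
        by (simp only: h(3))
    qed
    also have "\<dots> = (\<Sum>k=K..<Suc N. inverse (fact k) * (M * s) ^ k) * norm x"
      by (simp only: sum_distrib_right)
    also have "\<dots> \<le> e * norm x"
      using K[of K "Suc N"] by (intro mult_right_mono) auto
    finally show ?thesis .
  qed
  obtain B where B: "B \<ge> 0" "\<And>x. Q (L / 2) (?P x) \<le> B * Q L x"
    using Q_newton_le[of "L / 2" h K L "\<lambda>k. real (N choose k)"] L h by auto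
  show ?thesis
  proof (intro exI[of _ "2 * B"] conjI allI)
    fix x
    have "Q (L / 2) (?R x) \<le> Q 1 (?R x)" using L by (intro Q_mono) auto
    also have "\<dots> \<le> C * (norm (?R x))\<^sup>2" by (rule Q_le)
    also have "\<dots> \<le> C * (e * norm x)\<^sup>2"
      using R[of x] C_nonneg by (intro mult_left_mono power_mono) auto
    also have "\<dots> = C * e\<^sup>2 * (norm x)\<^sup>2" by (simp add: power_mult_distrib)
    finally have "2 * Q (L / 2) (?R x) \<le> 2 * (C * e\<^sup>2) * (norm x)\<^sup>2" by simp
    also have "\<dots> \<le> \<eta> * (norm x)\<^sup>2" using e(2) by (rule mult_right_mono) simp
    finally show "Q (L / 2) (U s x) \<le> 2 * B * Q L x + \<eta> * (norm x)\<^sup>2"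
      using Q_plus[of "L / 2" "?P x" "?R x"] B(2)[of x] L unfolding split by simp
  qed (use B in simp)
qed

text \<open>Consecutive windows of length \<open>L / 2\<close> are treated one at a time by
  \<open>Q_translate_le\<close>; the error budget is halved at each step, hence the induction over
  arbitrary \<open>\<eta>\<close>.\<close>

lemma Q_cover_le:
  assumes L: "0 < L" "L \<le> 1" and \<eta>: "\<eta> > 0"
  shows "\<exists>B\<ge>0. \<forall>x. Q (real n * (L / 2)) x \<le> B * Q L x + \<eta> * (norm x)\<^sup>2"
  using \<eta>
proof (induction n arbitrary: \<eta>)
  case 0
  have "Q 0 x = 0" for x using Q_split[of 0 0 x] by (simp add: U_0)
  then show ?case using 0 by (intro exI[of _ 0]) simp
next
  case (Suc n)
  obtain B1 where B1: "B1 \<ge> 0" "\<And>x. Q (real n * (L / 2)) x \<le> B1 * Q L x + \<eta> / 2 * (norm x)\<^sup>2"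
    using Suc.IH[of "\<eta> / 2"] Suc.prems by auto
  have "0 \<le> real n * (L / 2)" "0 < \<eta> / 2" using L Suc.prems by auto
  from Q_translate_le[OF L this] obtain B2 where B2: "B2 \<ge> 0"
    "\<And>x. Q (L / 2) (U (real n * (L / 2)) x) \<le> B2 * Q L x + \<eta> / 2 * (norm x)\<^sup>2"
    by blast
  show ?case
  proof (intro exI[of _ "B1 + B2"] conjI allI)
    fix x
    have eq: "real (Suc n) * (L / 2) = real n * (L / 2) + L / 2" by (simp add: field_simps)
    have "Q (real (Suc n) * (L / 2)) x = Q (real n * (L / 2)) x + Q (L / 2) (U (real n * (L / 2)) x)"
      unfolding eq by (rule Q_split) (use L in auto)
    also have "\<dots> \<le> (B1 + B2) * Q L x + \<eta> * (norm x)\<^sup>2"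
      using B1(2)[of x] B2(2)[of x] by (simp add: algebra_simps)
    finally show "Q (real (Suc n) * (L / 2)) x \<le> (B1 + B2) * Q L x + \<eta> * (norm x)\<^sup>2" .
  qed (use B1 B2 in simp)
qed

text \<open>Enough half-windows cover the unit interval, and the error
  \<open>c / 2 * (norm x)\<^sup>2\<close> is absorbed into the lower bound at time
  \<open>1\<close>.\<close>

theorem observable_short_time:
  assumes c: "c > 0" "\<And>x. c * (norm x)\<^sup>2 \<le> Q 1 x" and L: "L > 0"
  shows "\<exists>c'>0. \<forall>x. c' * (norm x)\<^sup>2 \<le> Q L x"
proof (cases "L \<le> 1")
  case False
  then show ?thesis using c Q_mono[of 1 L] by (meson linear order_trans zero_le_one)
next
  case True
  obtain n :: nat where n: "1 / (L / 2) \<le> real n" using real_arch_simple by blast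
  then have n1: "1 \<le> real n * (L / 2)" using L by (simp add: field_simps)
  obtain B where B: "B \<ge> 0" "\<And>x. Q (real n * (L / 2)) x \<le> B * Q L x + c / 2 * (norm x)\<^sup>2"
    using Q_cover_le[OF L True, of "c / 2" n] c by auto
  show ?thesis
  proof (intro exI[of _ "c / (2 * (B + 1))"] conjI allI)
    fix x
    have "c * (norm x)\<^sup>2 \<le> B * Q L x + c / 2 * (norm x)\<^sup>2"
      using c(2)[of x] Q_mono[OF _ n1, of x] B(2)[of x] by simp
    moreover have "B * Q L x \<le> (B + 1) * Q L x"
      using Q_nonneg[of L x] by (simp add: algebra_simps)
    ultimately have "c / 2 * (norm x)\<^sup>2 \<le> (B + 1) * Q L x" by simp
    then show "c / (2 * (B + 1)) * (norm x)\<^sup>2 \<le> Q L x"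
      using B(1) by (simp add: field_simps)
  qed (use c B in simp)
qed

lemma Q_le_any_time:
  assumes "L > 0"
  shows "\<exists>C'>0. \<forall>x. Q L x \<le> C' * (norm x)\<^sup>2"
proof -
  have "\<exists>C'\<ge>0. \<forall>x. Q (real n) x \<le> C' * (norm x)\<^sup>2" for n
  proof (induction n)
    case 0
    have "Q 0 x = 0" for x using Q_split[of 0 0 x] by (simp add: U_0)
    then show ?case by (intro exI[of _ 0]) simp
  next
    case (Suc n)
    then obtain C' where C': "C' \<ge> 0" "\<And>x. Q (real n) x \<le> C' * (norm x)\<^sup>2" by blast
    obtain B where B: "\<And>x. norm (U (real n) x) \<le> norm x * B" "B > 0"
      using bounded_linear.pos_bounded[OF U_linear] by blast
    show ?case
    proof (intro exI[of _ "C' + C * B\<^sup>2"] conjI allI)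
      fix x
      have "Q 1 (U (real n) x) \<le> C * (norm (U (real n) x))\<^sup>2" by (rule Q_le)
      also have "\<dots> \<le> C * (norm x * B)\<^sup>2"
        using B C_nonneg by (intro mult_left_mono power_mono) auto
      finally show "Q (real (Suc n)) x \<le> (C' + C * B\<^sup>2) * (norm x)\<^sup>2"
        using Q_split[of "real n" 1 x] C'(2)[of x]
        by (simp add: algebra_simps power_mult_distrib)
    qed (use C' C_nonneg in simp)
  qed
  moreover obtain n :: nat where n: "L \<le> real n" using real_arch_simple by blast
  ultimately obtain C' where C': "C' \<ge> 0" "\<And>x. Q (real n) x \<le> C' * (norm x)\<^sup>2" by blast
  have "Q L x \<le> (C' + 1) * (norm x)\<^sup>2" for x
    using Q_mono[OF less_imp_le[OF assms] n, of x] C'(2)[of x] zero_le_power2[of "norm x"]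
    unfolding distrib_right by linarith
  then show ?thesis using C'(1) by (intro exI[of _ "C' + 1"]) auto
qed

end

section \<open>Semi-continuous frames\<close>

lemma infsum_cmult_left_ennreal: "(\<Sum>\<^sub>\<infinity>x\<in>S. c * f x) = c * (\<Sum>\<^sub>\<infinity>x\<in>S. f x :: ennreal)"
  by (simp add: nonneg_infsum_complete SUP_mult_left_ennreal sum_distrib_left)

lemma infsum_mono_ennreal:
  fixes f g :: "'a \<Rightarrow> ennreal"
  shows "(\<And>x. x \<in> S \<Longrightarrow> f x \<le> g x) \<Longrightarrow> infsum f S \<le> infsum g S"
  by (intro infsum_mono nonneg_summable_on_complete) auto

lemma infsum_add_ennreal:
  fixes f g :: "'a \<Rightarrow> ennreal"
  shows "(\<Sum>\<^sub>\<infinity>x\<in>S. f x + g x) = infsum f S + infsum g S"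
  by (intro infsum_add nonneg_summable_on_complete) auto

text \<open>The two closed intervals share the point \<open>a\<close>, which is a null set; the
  second integral is then translated to start at \<open>0\<close>.\<close>

lemma set_nn_integral_Icc_shift:
  fixes h :: "real \<Rightarrow> ennreal"
  assumes [measurable]: "h \<in> borel_measurable borel" and "0 \<le> a" "0 \<le> b"
  shows "(\<integral>\<^sup>+t\<in>{0..a + b}. h t \<partial>lborel) =
    (\<integral>\<^sup>+t\<in>{0..a}. h t \<partial>lborel) + (\<integral>\<^sup>+t\<in>{0..b}. h (a + t) \<partial>lborel)"
proof -
  have "(\<integral>\<^sup>+t\<in>{0..a + b}. h t \<partial>lborel)
      = (\<integral>\<^sup>+t. h t * indicator {0..a} t + h t * indicator {a..a + b} t \<partial>lborel)"
    by (rule nn_integral_cong_AE)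
       (use AE_lborel_singleton[of a] assms in
        \<open>auto elim!: eventually_mono split: split_indicator\<close>)
  also have "\<dots> = (\<integral>\<^sup>+t\<in>{0..a}. h t \<partial>lborel) + (\<integral>\<^sup>+t\<in>{a..a + b}. h t \<partial>lborel)"
    by (rule nn_integral_add) auto
  also have "(\<integral>\<^sup>+t\<in>{a..a + b}. h t \<partial>lborel)
      = (\<integral>\<^sup>+t. h (a + 1 * t) * indicator {a..a + b} (a + 1 * t) \<partial>lborel)"
    by (subst nn_integral_real_affine[where c = 1 and t = a]) auto
  also have "\<dots> = (\<integral>\<^sup>+t\<in>{0..b}. h (a + t) \<partial>lborel)"
    by (intro nn_integral_cong) (auto split: split_indicator)
  finally show ?thesis .
qed

text \<open>Weak continuity provides measurability in time. The energy is studied in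
  \<open>ennreal\<close> first, since its finiteness is only known once an upper frame bound is
  available.\<close>

locale weakly_continuous_group =
  fixes U :: "real \<Rightarrow> 'a::complex_inner \<Rightarrow> 'a" and G :: "'a set"
  assumes U_linear: "bounded_linear (U t)"
    and U_add: "U (s + t) x = U s (U t x)"
    and U_continuous: "continuous_on UNIV (\<lambda>t. cinner (U t f) g)"
begin

definition energy :: "real \<Rightarrow> 'a \<Rightarrow> ennreal" where
  "energy L f = (\<Sum>\<^sub>\<infinity>g\<in>G. \<integral>\<^sup>+t\<in>{0..L}. ennreal ((cmod (cinner (U t f) g))\<^sup>2) \<partial>lborel)"

lemma U_measurable [measurable]: "(\<lambda>t. cinner (U t f) g) \<in> borel_measurable borel"
  by (rule borel_measurable_continuous_onI[OF U_continuous])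

lemma energy_split:
  assumes "0 \<le> a" "0 \<le> b"
  shows "energy (a + b) f = energy a f + energy b (U a f)"
proof -
  have "energy (a + b) f = (\<Sum>\<^sub>\<infinity>g\<in>G. (\<integral>\<^sup>+t\<in>{0..a}. ennreal ((cmod (cinner (U t f) g))\<^sup>2) \<partial>lborel) +
      (\<integral>\<^sup>+t\<in>{0..b}. ennreal ((cmod (cinner (U t (U a f)) g))\<^sup>2) \<partial>lborel))"
    unfolding energy_def
    by (subst set_nn_integral_Icc_shift[OF _ assms]) (simp_all add: add.commute[of a] U_add)
  then show ?thesis
    unfolding energy_def by (simp add: infsum_add_ennreal)
qed

lemma energy_scaleR: "energy L (r *\<^sub>R f) = ennreal (r\<^sup>2) * energy L f"
proof -
  have "(\<integral>\<^sup>+t\<in>{0..L}. ennreal ((cmod (cinner (U t (r *\<^sub>R f)) g))\<^sup>2) \<partial>lborel) =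
      ennreal (r\<^sup>2) * (\<integral>\<^sup>+t\<in>{0..L}. ennreal ((cmod (cinner (U t f) g))\<^sup>2) \<partial>lborel)" for g
    by (subst nn_integral_cmult[symmetric])
       (auto simp: linear_scale[OF bounded_linear.linear[OF U_linear]] cinner_scaleR_left
        norm_mult power_mult_distrib ennreal_mult mult.assoc)
  then show ?thesis
    unfolding energy_def by (simp add: infsum_cmult_left_ennreal)
qed

lemma energy_plus: "energy L (x + y) \<le> 2 * energy L x + 2 * energy L y"
proof -
  have sq: "ennreal ((cmod (u + v))\<^sup>2) \<le> 2 * ennreal ((cmod u)\<^sup>2) + 2 * ennreal ((cmod v)\<^sup>2)" for u v
  proof -
    have "(cmod (u + v))\<^sup>2 \<le> (cmod u + cmod v)\<^sup>2"
      by (intro power_mono norm_triangle_ineq) simp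
    also have "\<dots> \<le> 2 * (cmod u)\<^sup>2 + 2 * (cmod v)\<^sup>2"
      using zero_le_power2[of "cmod u - cmod v"] by (simp add: power2_sum power2_diff)
    finally have "ennreal ((cmod (u + v))\<^sup>2) \<le> ennreal (2 * (cmod u)\<^sup>2 + 2 * (cmod v)\<^sup>2)"
      by (rule ennreal_leI)
    then show ?thesis by (simp add: ennreal_plus ennreal_mult)
  qed
  have "(\<integral>\<^sup>+t\<in>{0..L}. ennreal ((cmod (cinner (U t (x + y)) g))\<^sup>2) \<partial>lborel) \<le>
      2 * (\<integral>\<^sup>+t\<in>{0..L}. ennreal ((cmod (cinner (U t x) g))\<^sup>2) \<partial>lborel) +
      2 * (\<integral>\<^sup>+t\<in>{0..L}. ennreal ((cmod (cinner (U t y) g))\<^sup>2) \<partial>lborel)" (is "?l \<le> 2 * ?x + 2 * ?y") for g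
  proof -
    have "?l \<le> (\<integral>\<^sup>+t. 2 * (ennreal ((cmod (cinner (U t x) g))\<^sup>2) * indicator {0..L} t) +
        2 * (ennreal ((cmod (cinner (U t y) g))\<^sup>2) * indicator {0..L} t) \<partial>lborel)"
      by (intro nn_integral_mono)
         (auto simp: linear_add[OF bounded_linear.linear[OF U_linear]] cinner_add_left sq
           split: split_indicator)
    also have "\<dots> = 2 * ?x + 2 * ?y"
      by (simp add: nn_integral_add nn_integral_cmult)
    finally show ?thesis .
  qed
  then have "energy L (x + y) \<le> (\<Sum>\<^sub>\<infinity>g\<in>G.
      2 * (\<integral>\<^sup>+t\<in>{0..L}. ennreal ((cmod (cinner (U t x) g))\<^sup>2) \<partial>lborel) +
      2 * (\<integral>\<^sup>+t\<in>{0..L}. ennreal ((cmod (cinner (U t y) g))\<^sup>2) \<partial>lborel))"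
    unfolding energy_def by (rule infsum_mono_ennreal)
  then show ?thesis
    unfolding energy_def by (simp add: infsum_add_ennreal infsum_cmult_left_ennreal)
qed

text \<open>Splitting off a unit interval passes to another vector of the orbit, so finiteness at
  time \<open>1\<close> is assumed for all vectors.\<close>

lemma energy_finite:
  assumes one: "\<And>f. energy 1 f < \<infinity>" and "0 \<le> L"
  shows "energy L f < \<infinity>"
proof -
  have nat: "energy (real n) f < \<infinity>" for n f
  proof (induction n arbitrary: f)
    case 0
    show ?case using one[of f] energy_split[of 0 1 f] by (auto simp: less_top)
  next
    case (Suc n)
    then show ?case using one energy_split[of "real n" 1 f] by (auto simp: add.commute less_top)
  qed
  obtain n :: nat where "L \<le> real n" using real_arch_simple by blast
  then show ?thesis
    using nat[of n f] energy_split[of L "real n - L" f] \<open>0 \<le> L\<close> by (auto simp: less_top)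
qed

end

text \<open>With an integrand constant in time each integral is the interval length times the same
  number, so both frame bounds scale by \<open>L\<close>.\<close>

lemma semicontinuous_frame_const_power:
  assumes const: "\<And>t. op_power A t = T" and L: "L > 0" and frame: "semicontinuous_frame A G 1"
  shows "semicontinuous_frame A G L"
proof -
  define S where "S f = (\<Sum>\<^sub>\<infinity>g\<in>G. ennreal ((cmod (cinner f (T g)))\<^sup>2))" for f
  have S: "(\<Sum>\<^sub>\<infinity>g\<in>G. \<integral>\<^sup>+t\<in>{0..L}. ennreal ((cmod (cinner f (op_power A t g)))\<^sup>2) \<partial>lborel) = ennreal L * S f"
    if "L > 0" for L f
    using that
    by (simp add: const S_def nn_integral_cmult_indicator mult.commute[of _ "ennreal L"]
        infsum_cmult_left_ennreal)
  obtain c C where cC: "c > 0" "C > 0" "\<And>f. ennreal (c * (norm f)\<^sup>2) \<le> S f"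
     "\<And>f. S f \<le> ennreal (C * (norm f)\<^sup>2)"
    using frame unfolding semicontinuous_frame_def S[OF zero_less_one] by auto
  show ?thesis
    unfolding semicontinuous_frame_def S[OF L]
  proof (rule exI[of _ "L * c"], intro conjI exI[of _ "L * C"] allI)
    show "L * c > 0" "L * C > 0" using L cC by simp_all
    show "ennreal (L * c * (norm f)\<^sup>2) \<le> ennreal L * S f" for f
      using mult_left_mono[OF cC(3)[of f], of "ennreal L"] L cC(1)
      by (simp add: ennreal_mult[symmetric] mult.assoc)
    show "ennreal L * S f \<le> ennreal (L * C * (norm f)\<^sup>2)" for f
      using mult_left_mono[OF cC(4)[of f], of "ennreal L"] L cC(2)
      by (simp add: ennreal_mult[symmetric] mult.assoc)
  qed
qed

text \<open>Moving the powers onto \<open>f\<close> as \<open>U\<close> turns the frame sums into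
  energies; the upper bound at time \<open>1\<close> makes them finite, and their real values
  satisfy the axioms of \<open>observed_semigroup\<close>.\<close>

lemma semicontinuous_frame_spectral:
  fixes A :: "'h::chilbert_space \<Rightarrow> 'h"
  assumes A: "bounded_clinear A" and inv: "op_invertible A" and sa: "selfadjoint A"
    and E: "is_spectral_measure A E" and L: "L > 0" and frame: "semicontinuous_frame A G 1"
  shows "semicontinuous_frame A G L"
proof -
  obtain U :: "real \<Rightarrow> 'h \<Rightarrow> 'h" and M :: real where
    U: "\<And>t. bounded_linear (U t)" "\<And>x. U 0 x = x" "\<And>s t x. U (s + t) x = U s (U t x)" "M \<ge> 0"
    "\<And>t x. \<bar>t\<bar> \<le> 1 \<Longrightarrow> norm (U t x - x) \<le> M * \<bar>t\<bar> * norm x"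
    and adj: "\<And>f t g. cinner f (op_power A t g) = cinner (U t f) g"
    by (rule op_power_adjoint_group[OF A inv sa E]) (rule that; assumption)
  \<comment> \<open>The Lipschitz bound gives continuity at time \<open>0\<close>; the group law and
    boundedness of \<open>U t\<close> transport it to time \<open>t\<close>.\<close>
  have U_cont: "isCont (\<lambda>t. U t x) t" for x t
  proof -
    have "(\<lambda>h. U h x - x) \<midarrow>0\<rightarrow> 0"
    proof (rule Lim_null_comparison)
      show "\<forall>\<^sub>F h in at 0. norm (U h x - x) \<le> M * \<bar>h\<bar> * norm x"
        unfolding eventually_at by (intro exI[of _ 1]) (auto simp: dist_norm intro: U(5))
      have "((\<lambda>h. M * \<bar>h\<bar> * norm x) \<longlongrightarrow> M * \<bar>0\<bar> * norm x) (at 0)"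
        by (intro tendsto_intros)
      then show "((\<lambda>h. M * \<bar>h\<bar> * norm x) \<longlongrightarrow> 0) (at 0)" by simp
    qed
    then have "(\<lambda>h. U t (U h x - x) + U t x) \<midarrow>0\<rightarrow> U t 0 + U t x"
      by (intro tendsto_intros bounded_linear.tendsto[OF U(1)])
    then have "(\<lambda>h. U (t + h) x) \<midarrow>0\<rightarrow> U t x"
      by (simp add: U(3) linear_simps[OF U(1)])
    then show ?thesis by (simp add: isCont_iff)
  qed
  interpret weakly_continuous_group U G
  proof (rule weakly_continuous_group.intro)
    show "continuous_on UNIV (\<lambda>t. cinner (U t f) g)" for f g
      by (intro continuous_at_imp_continuous_on ballI
          bounded_linear.isCont[OF bounded_linear_cinner_left] U_cont)
  qed (use U in auto)
  have frame_iff: "semicontinuous_frame A G L' \<longleftrightarrow>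
      (\<exists>c>0. \<exists>C>0. \<forall>f. ennreal (c * (norm f)\<^sup>2) \<le> energy L' f \<and> energy L' f \<le> ennreal (C * (norm f)\<^sup>2))" for L'
    unfolding semicontinuous_frame_def energy_def adj ..
  obtain c C where cC: "c > 0" "C > 0" "\<And>f. ennreal (c * (norm f)\<^sup>2) \<le> energy 1 f"
      "\<And>f. energy 1 f \<le> ennreal (C * (norm f)\<^sup>2)"
    using frame unfolding frame_iff by blast
  have fin: "energy L f < top" if "0 \<le> L" for L f
  proof -
    have "energy 1 f < \<infinity>" for f
      using cC(4)[of f] by (rule le_less_trans) simp
    then show ?thesis using energy_finite[OF _ that] by simp
  qed
  define Q where "Q L f = enn2real (energy L f)" for L f
  have energy_eq: "energy L f = ennreal (Q L f)" if "0 \<le> L" for L f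
    using fin[OF that] by (simp add: Q_def)
  have Q_nonneg: "Q L f \<ge> 0" for L f by (simp add: Q_def)
  interpret observed_semigroup U M Q C
  proof (rule observed_semigroup.intro)
    fix d :: real and x y r
    assume d: "d \<ge> 0"
    show "Q d (x + y) \<le> 2 * Q d x + 2 * Q d y"
      using energy_plus[of d x y] Q_nonneg[of d]
      by (simp add: energy_eq d ennreal_mult[symmetric] ennreal_plus[symmetric]
          flip: ennreal_numeral del: ennreal_plus)
    show "Q d (r *\<^sub>R x) = r\<^sup>2 * Q d x"
      by (simp add: Q_def energy_scaleR enn2real_mult)
  next
    show "Q (a + b) x = Q a x + Q b (U a x)" if "a \<ge> 0" "b \<ge> 0" for a b x
      using fin that by (simp add: Q_def energy_split enn2real_plus)
    show "Q 1 x \<le> C * (norm x)\<^sup>2" for x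
      using cC(4)[of x] cC(2) by (simp add: energy_eq)
    show "norm (U h x - x) \<le> M * h * norm x" if "0 \<le> h" "h \<le> 1" for h x
      using U(5)[of h x] that by simp
  qed (use U cC Q_nonneg in auto)
  have "c * (norm f)\<^sup>2 \<le> Q 1 f" for f
    using cC(3)[of f] Q_nonneg[of 1 f] by (simp add: energy_eq)
  from observable_short_time[OF cC(1) this L] Q_le_any_time[OF L] show ?thesis
    unfolding frame_iff energy_eq[OF less_imp_le[OF L]] by (meson ennreal_leI)
qed

theorem theorem5p5:
  fixes A :: "'h::chilbert_space \<Rightarrow> 'h" and G :: "'h set"
  assumes separable: "\<exists>D::'h set. countable D \<and> closure D = UNIV"
    and bounded: "bounded_clinear A"
    and invertible: "op_invertible A"
    and selfadjoint: "selfadjoint A"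
    and countable: "countable G"
  shows "semicontinuous_frame A G 1 \<longleftrightarrow> (\<forall>L>0. semicontinuous_frame A G L)"
proof
  assume frame: "semicontinuous_frame A G 1"
  show "\<forall>L>0. semicontinuous_frame A G L"
  proof (intro allI impI)
    fix L :: real assume L: "L > 0"
    show "semicontinuous_frame A G L"
    proof (cases "\<exists>E. is_spectral_measure A E")
      case True
      then show ?thesis
        using semicontinuous_frame_spectral[OF bounded invertible selfadjoint _ L frame] by blast
    next
      case False
      \<comment> \<open>No operator satisfies the description, and the resulting default value is
        the same for all \<open>t\<close>.\<close>
      then have "op_power A t = (THE T. False)" for t by (simp add: op_power_def)
      then show ?thesis by (rule semicontinuous_frame_const_power[OF _ L frame])
    qed
  qed
qed simp

end
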